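(* Let $N\ge 3$ and $0<\gamma_2<\gamma_1<\min\{N,2\}$. Then there exists a constant $\hat c_0>0$ depending only on $\gamma_1,\gamma_2$ and $N$ such that $m(c)=0$ for any $0<c<\hat c_0$. In addition, for any $0<c<\hat c_0$, there exists no minimizer of $m(c)$, i.e. there is no $u\in S(c)$ with $E(u)=m(c)$.
   Context: For $\gamma\in(0,N)$ and $u\in H^1(\mathbb{R}^N)$ write $D_\gamma(u):=\int_{\mathbb{R}^N}\int_{\mathbb{R}^N}\frac{|u(x)|^2|u(y)|^2}{|x-y|^{\gamma}}\,dx\,dy$. The energy is $E(u):=\frac12\int_{\mathbb{R}^N}|\nabla u|^2\,dx+\frac14 D_{\gamma_2}(u)-\frac14 D_{\gamma_1}(u)$. For $c>0$, $S(c):=\{u\in H^1(\mathbb{R}^N):\int_{\mathbb{R}^N}|u|^2\,dx=c\}$ and $m(c):=\inf_{u\in S(c)}E(u)$. *)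

theory Defs
  imports "HOL-Analysis.Analysis"
begin

text \<open>
  \<open>\<real>\<^sup>N\<close> is \<open>real ^ 'n\<close> with \<open>N = CARD('n)\<close>. Elements of \<open>H\<^sup>1(\<real>\<^sup>N)\<close> are complex-valued and
  are represented by Lebesgue measurable functions rather than by their a.e. equivalence
  classes; every quantity below depends only on the class.
\<close>

definition partial_deriv :: "'n::finite \<Rightarrow> (real ^ 'n \<Rightarrow> real) \<Rightarrow> real ^ 'n \<Rightarrow> real" where
  "partial_deriv i f x = frechet_derivative f (at x) (axis i 1)"

primrec C_diff :: "nat \<Rightarrow> (real ^ 'n::finite \<Rightarrow> real) \<Rightarrow> bool" where
  "C_diff 0 f \<longleftrightarrow> continuous_on UNIV f"
| "C_diff (Suc k) f \<longleftrightarrow> (\<forall>x. f differentiable at x) \<and> (\<forall>i. C_diff k (partial_deriv i f))"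

definition test_function :: "(real ^ 'n::finite \<Rightarrow> real) \<Rightarrow> bool" where
  "test_function \<phi> \<longleftrightarrow> (\<forall>k. C_diff k \<phi>) \<and> compact (closure {x. \<phi> x \<noteq> 0})"

definition locally_integrable :: "(real ^ 'n::finite \<Rightarrow> complex) \<Rightarrow> bool" where
  "locally_integrable u \<longleftrightarrow> (\<forall>K. compact K \<longrightarrow> set_integrable lebesgue K u)"

definition is_weak_partial ::
  "'n::finite \<Rightarrow> (real ^ 'n \<Rightarrow> complex) \<Rightarrow> (real ^ 'n \<Rightarrow> complex) \<Rightarrow> bool" where
  "is_weak_partial i u g \<longleftrightarrow>
     locally_integrable u \<and> locally_integrable g \<and>
     (\<forall>\<phi>. test_function \<phi> \<longrightarrow>
        (LINT x|lebesgue. partial_deriv i \<phi> x *\<^sub>R u x) = - (LINT x|lebesgue. \<phi> x *\<^sub>R g x))"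

text \<open>Weak derivatives are unique up to null sets, so the choice below is immaterial.\<close>

definition weak_partial :: "'n::finite \<Rightarrow> (real ^ 'n \<Rightarrow> complex) \<Rightarrow> real ^ 'n \<Rightarrow> complex" where
  "weak_partial i u = (SOME g. is_weak_partial i u g)"

definition L2_space :: "(real ^ 'n::finite \<Rightarrow> complex) set" where
  "L2_space = {u \<in> borel_measurable lebesgue. integrable lebesgue (\<lambda>x. (cmod (u x))\<^sup>2)}"

definition H1_space :: "(real ^ 'n::finite \<Rightarrow> complex) set" where
  "H1_space = {u \<in> L2_space. \<forall>i. \<exists>g \<in> L2_space. is_weak_partial i u g}"

definition grad_norm_sq :: "(real ^ 'n::finite \<Rightarrow> complex) \<Rightarrow> real ^ 'n \<Rightarrow> real" where
  "grad_norm_sq u x = (\<Sum>i\<in>UNIV. (cmod (weak_partial i u x))\<^sup>2)"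

text \<open>
  On \<open>H\<^sup>1\<close> both integrals converge whenever \<open>0 < \<gamma> < min N 2\<close>, so the convention that a
  divergent Bochner integral is \<open>0\<close> plays no role. On the null set \<open>x = y\<close> the integrand is \<open>0\<close>.
\<close>

definition D_energy :: "real \<Rightarrow> (real ^ 'n::finite \<Rightarrow> complex) \<Rightarrow> real" where
  "D_energy \<gamma> u =
     (LINT x|lebesgue. LINT y|lebesgue.
        (cmod (u x))\<^sup>2 * (cmod (u y))\<^sup>2 / norm (x - y) powr \<gamma>)"

definition energy :: "real \<Rightarrow> real \<Rightarrow> (real ^ 'n::finite \<Rightarrow> complex) \<Rightarrow> real" where
  "energy \<gamma>\<^sub>1 \<gamma>\<^sub>2 u =
     1 / 2 * (LINT x|lebesgue. grad_norm_sq u x)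
     + 1 / 4 * D_energy \<gamma>\<^sub>2 u - 1 / 4 * D_energy \<gamma>\<^sub>1 u"

definition mass_sphere :: "real \<Rightarrow> (real ^ 'n::finite \<Rightarrow> complex) set" where
  "mass_sphere c = {u \<in> H1_space. (LINT x|lebesgue. (cmod (u x))\<^sup>2) = c}"

text \<open>
  The infimum is taken in the extended reals, since \<open>Inf\<close> on \<open>real\<close> is unspecified for sets
  that are not bounded below. The type argument carries the dimension.
\<close>

definition min_energy :: "'n::finite itself \<Rightarrow> real \<Rightarrow> real \<Rightarrow> real \<Rightarrow> ereal" where
  "min_energy _ \<gamma>\<^sub>1 \<gamma>\<^sub>2 c =
     (INF u \<in> (mass_sphere c :: (real ^ 'n \<Rightarrow> complex) set). ereal (energy \<gamma>\<^sub>1 \<gamma>\<^sub>2 u))"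

end

theory Submission
  imports Defs
begin

text \<open>
  Since \<open>1 / r powr \<gamma>\<^sub>1 - 1 / r powr \<gamma>\<^sub>2 \<le> 1 / r\<^sup>2\<close> for every \<open>r > 0\<close>, Hardy's inequality
  \<open>\<integral> |u(y)|\<^sup>2 / |x - y|\<^sup>2 dy \<le> 4 \<integral> |\<nabla>u|\<^sup>2\<close> (valid for \<open>N \<ge> 3\<close>) bounds the difference of the two
  nonlocal terms by \<open>4 c \<integral> |\<nabla>u|\<^sup>2\<close>, so \<open>E(u) \<ge> (1/2 - c) \<integral> |\<nabla>u|\<^sup>2 > 0\<close> on \<open>S(c)\<close> for
  \<open>c < 1/2\<close>. Conversely, the mass-preserving dilations \<open>t\<^bsup>N/2\<^esup> u(t x)\<close> of a test function have
  energy tending to \<open>0\<close> as \<open>t \<rightarrow> 0\<close>. So the infimum is \<open>0\<close> and is not attained.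

  Hardy's inequality is proved for weak derivatives without mollification: testing against
  products of one-dimensional bumps gives \<open>u(x + h e\<^sub>i) - u(x) = \<integral>\<^sub>0\<^sup>h \<partial>\<^sub>i u(x + s e\<^sub>i) ds\<close> for almost
  every \<open>x\<close>, which replaces the product rule for \<open>|u|\<^sup>2\<close> in the usual integration by parts against
  the vector field \<open>(x - a) / (|x - a|\<^sup>2 + \<epsilon>)\<close>.
\<close>

section \<open>Smooth bumps and product test functions\<close>

text \<open>The Hardy constant 4 is the value of (2 / (N - 2))^2 at N = 3 and is kept for all larger
  N, so the threshold 1/2 depends on neither the exponents nor the dimension. In the Hardy step,
  with R = |x - a|^2 + \<epsilon>, the field (x - a) / R has divergence at least (N - 2) / R and
  squared length at most 1 / R. The parameter \<epsilon> makes the field bounded and Lipschitz along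
  the axes and keeps finite the integral that has to be absorbed. The obstacle is that
  \<open>is_weak_partial\<close> offers neither a product rule nor a chain rule for |u|^2. The
  difference identity asks of test functions only shifts along one axis and one-dimensional
  antiderivatives, both of which stay within products of bumps. Its null set depends on h, which is
  harmless because it is only integrated over x at a fixed h. A second obstacle is
  measure-theoretic: elements of H^1 are merely Lebesgue measurable and \<open>weak_partial\<close>
  is an arbitrary choice, whereas Fubini and translation invariance are applied to Borel functions.
  Hence the passage to Borel representatives before any estimate.\<close>

primrec C_diff_real :: "nat \<Rightarrow> (real \<Rightarrow> real) \<Rightarrow> bool" where
  "C_diff_real 0 f \<longleftrightarrow> continuous_on UNIV f"
| "C_diff_real (Suc k) f \<longleftrightarrow> (\<forall>x. f differentiable at x) \<and> C_diff_real k (deriv f)"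

lemma C_diff_real_SucI:
  assumes "\<And>x. (f has_real_derivative f' x) (at x)" "C_diff_real k f'"
  shows "C_diff_real (Suc k) f"
proof -
  have "deriv f = f'"
    using assms(1) DERIV_imp_deriv by blast
  with assms show ?thesis
    by (auto simp: real_differentiable_def)
qed

lemma C_diff_real_Suc_deriv:
  assumes "C_diff_real (Suc k) f"
  shows "(f has_real_derivative deriv f x) (at x)"
  using assms by (simp add: DERIV_deriv_iff_real_differentiable)

lemma C_diff_real_SucD: "C_diff_real (Suc k) f \<Longrightarrow> C_diff_real k f"
proof (induction k arbitrary: f)
  case 0
  then have "isCont f x" for x
    by (meson C_diff_real_Suc_deriv DERIV_isCont)
  then show ?case
    by (simp add: continuous_at_imp_continuous_on)
qed auto

lemma C_diff_real_const: "C_diff_real k (\<lambda>x. c)"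
proof (induction k arbitrary: c)
  case (Suc k)
  show ?case
    by (rule C_diff_real_SucI[where f' = "\<lambda>x. 0"]) (auto simp: Suc)
qed auto

lemma C_diff_real_add:
  "C_diff_real k f \<Longrightarrow> C_diff_real k g \<Longrightarrow> C_diff_real k (\<lambda>x. f x + g x)"
proof (induction k arbitrary: f g)
  case (Suc k)
  show ?case
    by (rule C_diff_real_SucI[where f' = "\<lambda>x. deriv f x + deriv g x"])
      (use Suc C_diff_real_Suc_deriv[OF Suc.prems(1)] C_diff_real_Suc_deriv[OF Suc.prems(2)]
       in \<open>auto intro!: derivative_eq_intros\<close>)
qed (auto intro: continuous_intros)

lemma C_diff_real_mult:
  "C_diff_real k f \<Longrightarrow> C_diff_real k g \<Longrightarrow> C_diff_real k (\<lambda>x. f x * g x)"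
proof (induction k arbitrary: f g)
  case (Suc k)
  show ?case
  proof (rule C_diff_real_SucI)
    show "((\<lambda>x. f x * g x) has_real_derivative f x * deriv g x + deriv f x * g x) (at x)" for x
      using C_diff_real_Suc_deriv[OF Suc.prems(1), of x] C_diff_real_Suc_deriv[OF Suc.prems(2), of x]
      by (auto intro!: derivative_eq_intros)
    show "C_diff_real k (\<lambda>x. f x * deriv g x + deriv f x * g x)"
      using Suc.prems C_diff_real_SucD by (intro C_diff_real_add Suc.IH) auto
  qed
qed (auto intro: continuous_intros)

lemma C_diff_real_diff:
  "C_diff_real k f \<Longrightarrow> C_diff_real k g \<Longrightarrow> C_diff_real k (\<lambda>x. f x - g x)"
  using C_diff_real_add[of k f "\<lambda>x. -1 * g x"] C_diff_real_mult[OF C_diff_real_const, of k g "-1"]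
  by simp

lemma C_diff_real_affine: "C_diff_real k f \<Longrightarrow> C_diff_real k (\<lambda>x. f (c * x + d))"
proof (induction k arbitrary: f)
  case 0
  then show ?case
    by (auto intro!: continuous_on_compose2[of UNIV f] continuous_intros)
next
  case (Suc k)
  show ?case
  proof (rule C_diff_real_SucI)
    show "((\<lambda>x. f (c * x + d)) has_real_derivative c * deriv f (c * x + d)) (at x)" for x
    proof -
      have "((\<lambda>x. c * x + d) has_real_derivative c) (at x)"
        by (auto intro!: derivative_eq_intros)
      from DERIV_chain2[OF C_diff_real_Suc_deriv[OF Suc.prems] this] show ?thesis
        by (simp add: mult.commute)
    qed
    show "C_diff_real k (\<lambda>x. c * deriv f (c * x + d))"
      using Suc by (intro C_diff_real_mult C_diff_real_const) auto
  qed
qed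

text \<open>The sign is left free because derivatives of bumps and antiderivatives of their
  differences must be bumps again.\<close>

definition bump :: "(real \<Rightarrow> real) \<Rightarrow> bool" where
  "bump f \<longleftrightarrow> (\<forall>k. C_diff_real k f) \<and> (\<exists>R. \<forall>t. R < \<bar>t\<bar> \<longrightarrow> f t = 0)"

lemma bumpE:
  assumes "bump f" obtains R where "R > 0" "\<And>t. R < \<bar>t\<bar> \<Longrightarrow> f t = 0"
proof -
  obtain R where "\<And>t. R < \<bar>t\<bar> \<Longrightarrow> f t = 0"
    using assms unfolding bump_def by blast
  then show ?thesis
    using that[of "max R 1"] by simp
qed

lemma bump_has_deriv: "bump f \<Longrightarrow> (f has_real_derivative deriv f x) (at x)"
  using C_diff_real_Suc_deriv unfolding bump_def by blast

lemma bump_continuous: "bump f \<Longrightarrow> continuous_on A f"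
  unfolding bump_def by (metis C_diff_real.simps(1) continuous_on_subset subset_UNIV)

lemma bump_deriv:
  assumes "bump f" shows "bump (deriv f)"
proof -
  obtain R where R: "R > 0" "\<And>t. R < \<bar>t\<bar> \<Longrightarrow> f t = 0"
    using bumpE[OF assms] by blast
  have "deriv f t = 0" if "R < \<bar>t\<bar>" for t
  proof -
    have "open {t. R < \<bar>t\<bar>}"
      by (intro open_Collect_less continuous_intros)
    then have "(f has_real_derivative 0) (at t)"
      using that R(2)
      by (intro has_field_derivative_transform_within_open[OF DERIV_const[of 0], where S = "{t. R < \<bar>t\<bar>}"]) auto
    then show ?thesis
      by (rule DERIV_imp_deriv)
  qed
  then show ?thesis
    using assms unfolding bump_def by (metis C_diff_real.simps(2))
qed

lemma bump_affine:
  assumes "bump f" "c \<noteq> 0" shows "bump (\<lambda>x. f (c * x + d))"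
proof -
  obtain R where R: "R > 0" "\<And>t. R < \<bar>t\<bar> \<Longrightarrow> f t = 0"
    using bumpE[OF assms(1)] by blast
  have "f (c * t + d) = 0" if "(R + \<bar>d\<bar>) / \<bar>c\<bar> < \<bar>t\<bar>" for t
  proof -
    have "R + \<bar>d\<bar> < \<bar>c * t\<bar>"
      using that assms(2) by (simp add: field_simps abs_mult)
    then show ?thesis
      by (intro R(2)) linarith
  qed
  then show ?thesis
    using assms unfolding bump_def by (blast intro: C_diff_real_affine)
qed

text \<open>An antiderivative of a bump is usually not compactly supported, but
  \<open>f t - f (t - h)\<close> has integral zero, so its antiderivative, the moving integral of
  \<open>f\<close> over a window of length \<open>h\<close>, is a bump. A weak derivative tested
  against \<open>B\<close> thereby produces a finite difference.\<close>

lemma bump_shift_antiderivative: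
  assumes "bump f" "h \<ge> 0"
  obtains B where "bump B" "\<And>t. deriv B t = f t - f (t - h)"
    "\<And>t. ((\<lambda>s. f (t - s)) has_integral B t) {0..h}"
proof -
  obtain R where R: "R > 0" "\<And>t. R < \<bar>t\<bar> \<Longrightarrow> f t = 0"
    using bumpE[OF assms(1)] by blast
  \<comment> \<open>Starting strictly to the left of \<open>-R\<close> makes every
    \<open>t >= -R\<close> an interior point of \<open>{-R - 1..t + 1}\<close>. For
    \<open>t < -R\<close> the integral is 0, whether or not the interval is empty.\<close>
  define A where "A t = integral {-R - 1..t} f" for t
  have A: "(A has_real_derivative f t) (at t)" for t
  proof (cases "t < -R")
    case True
    have "A u = 0" if "u < -R" for u
      unfolding A_def using that R(1)
      by (intro integral_unique has_integral_is_0) (auto intro!: R(2))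
    then have "(A has_real_derivative 0) (at t)"
      using True by (intro has_field_derivative_transform_within_open[OF DERIV_const[of 0], where S = "{..< -R}"]) auto
    moreover have "f t = 0"
      using True R(1) by (intro R(2)) auto
    ultimately show ?thesis by simp
  next
    case False
    then have "(A has_real_derivative f t) (at t within {-R - 1..t + 1})"
      unfolding A_def[abs_def]
      by (intro integral_has_real_derivative bump_continuous[OF assms(1)]) auto
    moreover have "at t within {-R - 1..t + 1} = at t"
      using False by (intro at_within_interior) auto
    ultimately show ?thesis by simp
  qed
  define B where "B t = A t - A (t - h)" for t
  have dB: "(B has_real_derivative f t - f (t - h)) (at t)" for t
  proof -
    have "((\<lambda>t. t - h) has_real_derivative 1) (at t)"
      by (auto intro!: derivative_eq_intros)
    from DERIV_diff[OF A DERIV_chain2[OF A this]] show ?thesis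
      unfolding B_def[abs_def] by simp
  qed
  have int: "((\<lambda>s. f (t - s)) has_integral B t) {0..h}" for t
  proof -
    have "((\<lambda>s. - A (t - s)) has_real_derivative f (t - s)) (at s)" for s
    proof -
      have "((\<lambda>s. t - s) has_real_derivative -1) (at s)"
        by (auto intro!: derivative_eq_intros)
      from DERIV_minus[OF DERIV_chain2[OF A this]] show ?thesis by simp
    qed
    then have "((\<lambda>s. f (t - s)) has_integral (- A (t - h)) - (- A (t - 0))) {0..h}"
      using assms(2)
      by (intro fundamental_theorem_of_calculus)
         (auto simp: has_real_derivative_iff_has_vector_derivative intro: has_vector_derivative_at_within)
    then show ?thesis by (simp add: B_def)
  qed
  have "B t = 0" if "R + h < \<bar>t\<bar>" for t
  proof -
    have "((\<lambda>s. f (t - s)) has_integral 0) {0..h}"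
      using that assms(2) by (intro has_integral_is_0) (auto intro!: R(2))
    with int show ?thesis by (rule has_integral_unique)
  qed
  moreover have "C_diff_real k B" for k
  proof (cases k)
    case 0
    show ?thesis
      using DERIV_isCont[OF dB] by (auto simp: 0 continuous_at_imp_continuous_on)
  next
    case (Suc j)
    have "C_diff_real j (\<lambda>t. f t - f (t - h))"
      using assms(1) C_diff_real_affine[of j f 1 "-h"]
      by (intro C_diff_real_diff) (auto simp: bump_def)
    with dB show ?thesis
      unfolding Suc by (rule C_diff_real_SucI)
  qed
  ultimately have "bump B"
    unfolding bump_def by blast
  then show ?thesis
    using int DERIV_imp_deriv[OF dB] that by blast
qed

section \<open>The smooth cutoff exp(-1/t) and bumps approximating intervals\<close>

definition flat_exp :: "nat \<Rightarrow> real \<Rightarrow> real" where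
  "flat_exp m t = (if t > 0 then (1 / t) ^ m * exp (- (1 / t)) else 0)"

lemma flat_exp_tendsto_0: "(flat_exp m \<longlongrightarrow> 0) (at 0)"
proof -
  have "((\<lambda>s::real. s ^ m / exp s) \<longlongrightarrow> 0) at_top"
    by (rule tendsto_power_div_exp_0)
  then have "((\<lambda>t::real. inverse t ^ m / exp (inverse t)) \<longlongrightarrow> 0) (at_right 0)"
    by (rule filterlim_compose[OF _ filterlim_inverse_at_top_right])
  then have R: "(flat_exp m \<longlongrightarrow> 0) (at_right 0)"
    by (rule Lim_transform_eventually)
       (auto simp: eventually_at_filter flat_exp_def exp_minus field_simps)
  have L: "(flat_exp m \<longlongrightarrow> 0) (at_left 0)"
    by (rule Lim_transform_eventually[OF tendsto_const]) (auto simp: eventually_at_filter flat_exp_def)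
  from L R show ?thesis
    by (simp add: filterlim_split_at)
qed

text \<open>The powers of 1/t are carried along because the family is closed under differentiation
  up to linear combinations. Smoothness of exp(-1/t) then follows by induction on the order with
  \<open>m\<close> arbitrary.\<close>

lemma flat_exp_deriv:
  "(flat_exp m has_real_derivative flat_exp (m + 2) t + - real m * flat_exp (m + 1) t) (at t)"
proof (cases t "0 :: real" rule: linorder_cases)
  case less
  have "(flat_exp m has_real_derivative 0) (at t)"
    using less by (intro has_field_derivative_transform_within_open[OF DERIV_const[of 0], where S = "{..<0}"])
      (auto simp: flat_exp_def)
  then show ?thesis using less by (simp add: flat_exp_def)
next
  case equal
  \<comment> \<open>At the origin the difference quotient of \<open>flat_exp m\<close> is exactly
    \<open>flat_exp (Suc m)\<close>, so differentiability there reduces to the limit already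
    known.\<close>
  have "((\<lambda>h. (flat_exp m (0 + h) - flat_exp m 0) / h) \<longlongrightarrow> 0) (at 0)"
    by (rule Lim_transform_eventually[OF flat_exp_tendsto_0[of "Suc m"]])
       (auto simp: flat_exp_def)
  then show ?thesis
    unfolding equal by (simp add: DERIV_def flat_exp_def)
next
  case greater
  define s where "s = 1 / t"
  have inv: "((\<lambda>t. 1 / t) has_real_derivative - (s ^ 2)) (at t)"
    using greater by (auto intro!: derivative_eq_intros simp: s_def power2_eq_square)
  have "((\<lambda>s. s ^ m * exp (- s)) has_real_derivative
      real m * s ^ (m - 1) * exp (- s) - s ^ m * exp (- s)) (at (1 / t))"
    unfolding s_def by (auto intro!: derivative_eq_intros)
  from DERIV_chain2[OF this inv] have "((\<lambda>t. (1 / t) ^ m * exp (- (1 / t))) has_real_derivative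
      (real m * s ^ (m - 1) * exp (- s) - s ^ m * exp (- s)) * (- (s ^ 2))) (at t)" .
  also have "(real m * s ^ (m - 1) * exp (- s) - s ^ m * exp (- s)) * (- (s ^ 2))
      = flat_exp (m + 2) t + - real m * flat_exp (m + 1) t"
    using greater
    by (cases m) (simp_all add: flat_exp_def s_def[symmetric] algebra_simps power2_eq_square)
  finally have "((\<lambda>t. (1 / t) ^ m * exp (- (1 / t))) has_real_derivative
      flat_exp (m + 2) t + - real m * flat_exp (m + 1) t) (at t)" .
  then show ?thesis
    by (rule has_field_derivative_transform_within_open[where S = "{0<..}"])
       (use greater in \<open>auto simp: flat_exp_def\<close>)
qed

lemma C_diff_real_flat_exp: "C_diff_real k (flat_exp m)"
proof (induction k arbitrary: m)
  case 0
  show ?case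
    using DERIV_isCont[OF flat_exp_deriv] by (auto simp: continuous_at_imp_continuous_on)
next
  case (Suc k)
  show ?case
    by (rule C_diff_real_SucI[OF flat_exp_deriv])
       (intro C_diff_real_add C_diff_real_mult C_diff_real_const Suc)
qed

text \<open>Steepening the cutoffs by \<open>Suc n\<close> gives the indicator of the open interval
  in the limit: at distance d > 0 inside an endpoint the factor exp(-1/((n+1) d)) tends to 1, and
  outside the product vanishes for every \<open>n\<close>.\<close>

definition interval_bump :: "real \<Rightarrow> real \<Rightarrow> nat \<Rightarrow> real \<Rightarrow> real" where
  "interval_bump a b n t = flat_exp 0 (real (Suc n) * (t - a)) * flat_exp 0 (real (Suc n) * (b - t))"

lemma bump_interval_bump: "bump (interval_bump a b n)"
proof -
  define M where "M = real (Suc n)"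
  have "C_diff_real k (\<lambda>t. flat_exp 0 (M * t + - M * a) * flat_exp 0 (- M * t + M * b))" for k
    by (intro C_diff_real_mult C_diff_real_affine C_diff_real_flat_exp)
  then have "C_diff_real k (interval_bump a b n)" for k
    by (simp add: interval_bump_def[abs_def] M_def algebra_simps)
  moreover have "interval_bump a b n t = 0" if "\<bar>a\<bar> + \<bar>b\<bar> < \<bar>t\<bar>" for t
  proof -
    have "t - a \<le> 0 \<or> b - t \<le> 0" using that by linarith
    then show ?thesis
      by (auto simp: interval_bump_def flat_exp_def zero_less_mult_iff)
  qed
  ultimately show ?thesis
    unfolding bump_def by blast
qed

lemma flat_exp_0_bounds: "0 \<le> flat_exp 0 t" "flat_exp 0 t \<le> 1"
  by (auto simp: flat_exp_def)

lemma interval_bump_bounds: "0 \<le> interval_bump a b n t" "interval_bump a b n t \<le> 1"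
  by (auto simp: interval_bump_def flat_exp_0_bounds mult_le_one)

lemma interval_bump_tendsto:
  "(\<lambda>n. interval_bump a b n t) \<longlonglongrightarrow> (if a < t \<and> t < b then 1 else 0)"
proof (cases "a < t \<and> t < b")
  case True
  have *: "(\<lambda>n. flat_exp 0 (real (Suc n) * d)) \<longlonglongrightarrow> 1" if "d > 0" for d
  proof -
    have "(\<lambda>n. exp (- (inverse (real (Suc n)) * (1 / d)))) \<longlonglongrightarrow> exp (- (0 * (1 / d)))"
      by (intro tendsto_intros LIMSEQ_inverse_real_of_nat)
    moreover have "flat_exp 0 (real (Suc n) * d) = exp (- (inverse (real (Suc n)) * (1 / d)))" for n
      using that by (simp add: flat_exp_def inverse_eq_divide zero_less_mult_iff del: of_nat_Suc)
    ultimately show ?thesis by simp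
  qed
  have "(\<lambda>n. interval_bump a b n t) \<longlonglongrightarrow> 1 * 1"
    unfolding interval_bump_def using True by (intro tendsto_mult *) auto
  with True show ?thesis by simp
next
  case False
  then have "interval_bump a b n t = 0" for n
    by (auto simp: interval_bump_def flat_exp_def zero_less_mult_iff simp del: of_nat_Suc)
  then show ?thesis by (simp add: False)
qed

lemma interval_bump_outside: "\<not> (a < t \<and> t < b) \<Longrightarrow> interval_bump a b n t = 0"
  by (auto simp: interval_bump_def flat_exp_def zero_less_mult_iff simp del: of_nat_Suc)

text \<open>Tensor products serve as the test functions: a partial derivative or a shift along an
  axis changes one factor only, and products of interval bumps converge to indicators of
  boxes.\<close>

definition prod_fun :: "('n::finite \<Rightarrow> real \<Rightarrow> real) \<Rightarrow> real ^ 'n \<Rightarrow> real" where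
  "prod_fun b x = (\<Prod>j\<in>UNIV. b j (x $ j))"

lemma prod_fun_split: "prod_fun b x = b i (x $ i) * (\<Prod>j\<in>UNIV - {i}. b j (x $ j))"
  by (simp add: prod_fun_def prod.remove)

lemma prod_fun_upd: "prod_fun (b(i := f)) x = f (x $ i) * (\<Prod>j\<in>UNIV - {i}. b j (x $ j))"
  by (simp add: prod_fun_split[of _ _ i])

lemma prod_fun_has_derivative:
  assumes "\<And>j. bump (b j)"
  shows "(prod_fun b has_derivative (\<lambda>v. \<Sum>i\<in>UNIV. (v $ i) * prod_fun (b(i := deriv (b i))) x)) (at x)"
proof -
  have "((\<lambda>x. b j (x $ j)) has_derivative (\<lambda>v. deriv (b j) (x $ j) * (v $ j))) (at x)" for j
    using has_derivative_compose[OF bounded_linear_imp_has_derivative[OF bounded_linear_vec_nth[of j]]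
        bump_has_deriv[OF assms, of j "x $ j", unfolded has_field_derivative_def]]
    by (simp add: o_def)
  then have "((\<lambda>x. \<Prod>j\<in>UNIV. b j (x $ j)) has_derivative
     (\<lambda>v. \<Sum>i\<in>UNIV. (deriv (b i) (x $ i) * (v $ i)) * (\<Prod>j\<in>UNIV - {i}. b j (x $ j)))) (at x)"
    by (intro has_derivative_prod) auto
  then show ?thesis
    unfolding prod_fun_upd by (simp add: prod_fun_def[abs_def] ac_simps)
qed

lemma partial_deriv_prod_fun:
  assumes "\<And>j. bump (b j)"
  shows "partial_deriv i (prod_fun b) = prod_fun (b(i := deriv (b i)))"
proof
  fix x
  have "partial_deriv i (prod_fun b) x =
    (\<Sum>k\<in>UNIV. ((axis i 1 :: real ^ 'a) $ k) * prod_fun (b(k := deriv (b k))) x)"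
    unfolding partial_deriv_def frechet_derivative_at[OF prod_fun_has_derivative[OF assms], symmetric] ..
  also have "\<dots> = prod_fun (b(i := deriv (b i))) x"
    by (simp add: axis_def if_distrib[of "\<lambda>c. c * _"] cong: if_cong)
  finally show "partial_deriv i (prod_fun b) x = prod_fun (b(i := deriv (b i))) x" .
qed

lemma bump_upd: "(\<And>j. bump (b j)) \<Longrightarrow> bump f \<Longrightarrow> bump ((b(i := f)) j)"
  by simp

lemma continuous_on_prod_fun:
  assumes "\<And>j. bump (b j)" shows "continuous_on A (prod_fun b)"
  unfolding prod_fun_def[abs_def]
  by (intro continuous_on_prod continuous_on_compose2[OF bump_continuous[OF assms, of UNIV]] continuous_intros) auto

lemma C_diff_prod_fun: "(\<And>j. bump (b j)) \<Longrightarrow> C_diff k (prod_fun b)"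
proof (induction k arbitrary: b)
  case 0
  then show ?case by (simp add: continuous_on_prod_fun)
next
  case (Suc k)
  have "C_diff k (partial_deriv i (prod_fun b))" for i
    unfolding partial_deriv_prod_fun[OF Suc.prems]
    by (intro Suc.IH bump_upd bump_deriv Suc.prems)
  moreover have "prod_fun b differentiable at x" for x
    using prod_fun_has_derivative[OF Suc.prems] by (rule differentiableI)
  ultimately show ?case by simp
qed

lemma prod_fun_support:
  assumes "\<And>j. bump (b j)"
  obtains R where "R > 0" "\<And>x. x \<notin> cbox (\<chi> i. - R) (\<chi> i. R) \<Longrightarrow> prod_fun b x = 0"
proof -
  have "\<exists>R. \<forall>t. R < \<bar>t\<bar> \<longrightarrow> b j t = 0" for j
    using assms[of j] by (simp add: bump_def)
  then obtain r where r: "\<And>j t. r j < \<bar>t\<bar> \<Longrightarrow> b j t = 0" by metis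
  define R where "R = Max (insert 1 (range r))"
  have R: "R \<ge> 1" "\<And>j. r j \<le> R"
    unfolding R_def by (simp_all only: Max_ge finite_insert finite insertI1 insertI2 rangeI finite_imageI)
  have "prod_fun b x = 0" if x: "x \<notin> cbox (\<chi> i. - R) (\<chi> i. R)" for x
  proof -
    obtain j where "\<not> (- R \<le> x $ j \<and> x $ j \<le> R)"
      using x by (auto simp: mem_box_cart)
    then have "r j < \<bar>x $ j\<bar>" using R(2)[of j] by linarith
    then show ?thesis by (simp add: prod_fun_split[of _ _ j] r)
  qed
  with R(1) show ?thesis by (intro that[of R]) simp_all
qed

lemma test_function_prod_fun:
  assumes "\<And>j. bump (b j)" shows "test_function (prod_fun b)"
proof -
  obtain R where R: "\<And>x. x \<notin> cbox (\<chi> i. - R) (\<chi> i. R) \<Longrightarrow> prod_fun b x = 0"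
    using prod_fun_support[of b, OF assms] by blast
  have "{x. prod_fun b x \<noteq> 0} \<subseteq> cbox (\<chi> i. - R) (\<chi> i. R)"
    using R by blast
  from bounded_subset[OF bounded_cbox this]
  have "compact (closure {x. prod_fun b x \<noteq> 0})"
    by (simp only: compact_closure)
  with C_diff_prod_fun[of b, OF assms] show ?thesis
    by (simp add: test_function_def)
qed

section \<open>The fundamental lemma and differences of Sobolev functions\<close>

text \<open>The real-valued result is applied to real and imaginary parts separately.\<close>

lemma complex_ex_borel_measurable:
  fixes u :: "'a \<Rightarrow> complex"
  assumes "u \<in> borel_measurable (completion M)"
  shows "\<exists>v\<in>borel_measurable M. AE x in M. u x = v x"
proof -
  have "(\<lambda>x. Re (u x)) \<in> borel_measurable (completion M)" "(\<lambda>x. Im (u x)) \<in> borel_measurable (completion M)"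
    using assms by measurable
  from this[THEN completion_ex_borel_measurable_real]
  obtain r s where [measurable]: "r \<in> borel_measurable M" "s \<in> borel_measurable M"
    and "AE x in M. Re (u x) = r x" "AE x in M. Im (u x) = s x"
    by blast
  then have "(\<lambda>x. Complex (r x) (s x)) \<in> borel_measurable M" "AE x in M. u x = Complex (r x) (s x)"
    by (auto simp: Complex_eq complex_eq_iff)
  then show ?thesis by (intro bexI[where x = "\<lambda>x. Complex (r x) (s x)"])
qed

text \<open>Boxes are stable under intersection and generate the Borel sets, so vanishing integrals
  spread from boxes to all Borel sets by a Dynkin argument. Cutting off to the cubes
  \<open>B n\<close> turns the locally integrable \<open>f\<close> into an integrable function and
  preserves the hypothesis, since a box meets a cube in a box.\<close>

lemma AE_zero_if_box_integrals_zero: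
  fixes f :: "'a::euclidean_space \<Rightarrow> 'b::{banach, second_countable_topology}"
  assumes int: "\<And>a b. set_integrable lborel (box a b) f"
    and zero: "\<And>a b. set_lebesgue_integral lborel (box a b) f = 0"
  shows "AE x in lborel. f x = 0"
proof -
  define B :: "nat \<Rightarrow> 'a set" where "B n = box (- (real n *\<^sub>R One)) (real n *\<^sub>R One)" for n
  have "AE x in lborel. indicator (B n) x *\<^sub>R f x = 0" for n
  proof (rule sigma_finite_measure.density_zero[OF sigma_finite_lborel])
    define g where "g x = indicator (B n) x *\<^sub>R f x" for x
    have g: "integrable lborel g"
      using int[of "- (real n *\<^sub>R One)" "real n *\<^sub>R One"] by (simp add: g_def[abs_def] B_def set_integrable_def)
    then show "integrable lborel (\<lambda>x. indicator (B n) x *\<^sub>R f x)"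
      by (simp add: g_def[abs_def])
    have gi: "integrable lborel (\<lambda>x. indicator A x *\<^sub>R g x)" if "A \<in> sets borel" for A
      using that g by (intro integrable_mult_indicator) auto
    have box0: "(LINT x:box a b|lborel. g x) = 0" for a b
    proof -
      have "(LINT x:box a b|lborel. g x) = (LINT x:box a b \<inter> B n|lborel. f x)"
        unfolding set_lebesgue_integral_def g_def by (simp add: indicator_inter_arith)
      then show ?thesis unfolding B_def by (simp only: box_Int_box zero)
    qed
    have "(LINT x:A|lborel. g x) = 0" if "A \<in> sigma_sets UNIV (range (\<lambda>(a, b). box a b))" for A
    proof -
      have "Int_stable (range (\<lambda>(a, b). box a b :: 'a set))" "range (\<lambda>(a, b). box a b :: 'a set) \<subseteq> Pow UNIV"
        by (auto simp: Int_stable_def box_Int_box)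
      then show ?thesis
        using that
      proof (induction rule: sigma_sets_induct_disjoint)
        case (basic A)
        then show ?case using box0 by auto
      next
        case empty
        show ?case by (simp add: set_lebesgue_integral_def)
      next
        case (compl A)
        then have A: "A \<in> sets borel" by (simp add: borel_eq_box)
        \<comment> \<open>Complements need the integral over the whole space, which for the
          truncated function is again a box integral.\<close>
        have U: "(LINT x|lborel. g x) = 0"
        proof -
          have "g = (\<lambda>x. indicator (B n) x *\<^sub>R f x)" by (simp add: g_def[abs_def])
          then show ?thesis using zero[of "- (real n *\<^sub>R One)" "real n *\<^sub>R One"]
            by (simp add: set_lebesgue_integral_def B_def)
        qed
        have "(LINT x:UNIV - A|lborel. g x) = (LINT x|lborel. g x - indicator A x *\<^sub>R g x)"
          unfolding set_lebesgue_integral_def by (intro Bochner_Integration.integral_cong) (auto simp: indicator_def)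
        also have "\<dots> = 0"
          using compl U gi[OF A] g by (simp add: set_lebesgue_integral_def)
        finally show ?case .
      next
        case (union A)
        then have A: "A k \<in> sets borel" for k by (auto simp: borel_eq_box)
        have "(LINT x:(\<Union>i. A i)|lborel. g x) = (\<Sum>i. (LINT x:(A i)|lborel. g x))"
          using union(1) A gi[of "\<Union>i. A i"]
          by (intro lebesgue_integral_countable_add) (auto simp: disjoint_family_on_def set_integrable_def)
        then show ?case using union by simp
      qed
    qed
    then show "(LINT x:A|lborel. indicator (B n) x *\<^sub>R f x) = 0" if "A \<in> sets lborel" for A
      using that by (simp add: g_def borel_eq_box)
  qed
  then have "AE x in lborel. \<forall>n. indicator (B n) x *\<^sub>R f x = 0"
    unfolding AE_all_countable by (rule allI)
  then show ?thesis
  proof eventually_elim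
    case (elim x)
    have "x \<in> (\<Union>n. B n)" unfolding B_def by (simp only: UN_box_eq_UNIV UNIV_I)
    then obtain n where "x \<in> B n" by blast
    with elim[rule_format, of n] show ?case
      by (simp only: indicator_simps scaleR_one)
  qed
qed

text \<open>The fundamental lemma of the calculus of variations with tensor products only: products
  of interval bumps converge boundedly to the indicator of a box, and dominated convergence passes
  to the box integrals.\<close>

lemma AE_zero_if_prod_fun_integrals_zero:
  fixes f :: "real ^ 'n::finite \<Rightarrow> 'b::{banach, second_countable_topology}"
  assumes int: "\<And>a b. set_integrable lborel (box a b) f"
    and zero: "\<And>b. (\<And>j. bump (b j)) \<Longrightarrow> (LINT x|lborel. prod_fun b x *\<^sub>R f x) = 0"
  shows "AE x in lborel. f x = 0"
proof (rule AE_zero_if_box_integrals_zero[OF int])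
  fix a b :: "real ^ 'n"
  define \<phi> where "\<phi> n = prod_fun (\<lambda>j. interval_bump (a $ j) (b $ j) n)" for n
  have \<phi>0: "\<phi> n x = 0" if x: "x \<notin> box a b" for n x
  proof -
    obtain j where "\<not> (a $ j < x $ j \<and> x $ j < b $ j)"
      using x by (auto simp: mem_box_cart)
    then show ?thesis
      unfolding \<phi>_def by (simp add: prod_fun_split[of _ _ j] interval_bump_outside)
  qed
  have \<phi>1: "\<bar>\<phi> n x\<bar> \<le> 1" for n x
    unfolding \<phi>_def prod_fun_def by (auto simp: abs_prod interval_bump_bounds intro!: prod_le_1)
  have meas: "\<phi> n \<in> borel_measurable borel" for n
    unfolding \<phi>_def by (intro borel_measurable_continuous_onI continuous_on_prod_fun bump_interval_bump)
  have lim: "(\<lambda>n. \<phi> n x) \<longlonglongrightarrow> indicator (box a b) x" for x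
  proof (cases "x \<in> box a b")
    case True
    then have "a $ j < x $ j \<and> x $ j < b $ j" for j by (simp add: mem_box_cart)
    then have "(\<lambda>n. interval_bump (a $ j) (b $ j) n (x $ j)) \<longlonglongrightarrow> 1" for j
      using interval_bump_tendsto[of "a $ j" "b $ j" "x $ j"] by simp
    then have "(\<lambda>n. \<phi> n x) \<longlonglongrightarrow> (\<Prod>j\<in>(UNIV::'n set). 1)"
      unfolding \<phi>_def prod_fun_def by (intro tendsto_prod)
    with True show ?thesis by simp
  qed (simp add: \<phi>0)
  define F where "F x = indicator (box a b) x *\<^sub>R f x" for x
  have F: "integrable lborel F"
    using int[of a b] by (simp add: F_def[abs_def] set_integrable_def)
  \<comment> \<open>Since the bumps vanish off the box, \<open>f\<close> may be replaced by its
    truncation \<open>F\<close>, which is integrable and dominates.\<close>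
  have eq: "\<phi> n x *\<^sub>R f x = \<phi> n x *\<^sub>R F x" for n x
    using \<phi>0[of x n] by (auto simp: F_def indicator_def)
  have "(\<lambda>n. LINT x|lborel. \<phi> n x *\<^sub>R F x) \<longlonglongrightarrow> (LINT x|lborel. F x)"
  proof (rule integral_dominated_convergence[where w = "\<lambda>x. norm (F x)"])
    show "AE x in lborel. (\<lambda>n. \<phi> n x *\<^sub>R F x) \<longlonglongrightarrow> F x"
    proof (rule AE_I2)
      fix x
      have "(\<lambda>n. \<phi> n x *\<^sub>R F x) \<longlonglongrightarrow> indicator (box a b) x *\<^sub>R F x"
        by (intro tendsto_intros lim)
      moreover have "indicator (box a b) x *\<^sub>R F x = F x"
        by (simp add: F_def indicator_def)
      ultimately show "(\<lambda>n. \<phi> n x *\<^sub>R F x) \<longlonglongrightarrow> F x" by simp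
    qed
    show "AE x in lborel. norm (\<phi> n x *\<^sub>R F x) \<le> norm (F x)" for n
      using \<phi>1[of n] by (auto intro!: mult_left_le_one_le)
  qed (use F meas in \<open>auto intro!: borel_measurable_scaleR\<close>)
  moreover have "(LINT x|lborel. \<phi> n x *\<^sub>R F x) = 0" for n
    unfolding eq[symmetric] unfolding \<phi>_def by (intro zero bump_interval_bump)
  ultimately have "(LINT x|lborel. F x) = 0"
    by (simp add: LIMSEQ_const_iff)
  then show "(LINT x:box a b|lborel. f x) = 0"
    by (simp add: F_def set_lebesgue_integral_def)
qed

section \<open>Translations, and Fubini in the point and the shift\<close>

lemma integral_lborel_translation:
  fixes f :: "'a::euclidean_space \<Rightarrow> 'b::{banach, second_countable_topology}"
  assumes [measurable]: "f \<in> borel_measurable borel"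
  shows "(LINT x|lborel. f (x + c)) = (LINT x|lborel. f x)"
  using integral_distr[of "(+) c" lborel borel f] lborel_distr_plus[of c] by (simp add: add.commute)

lemma integrable_lborel_translation:
  fixes f :: "'a::euclidean_space \<Rightarrow> 'b::{banach, second_countable_topology}"
  assumes [measurable]: "f \<in> borel_measurable borel"
  shows "integrable lborel (\<lambda>x. f (x + c)) \<longleftrightarrow> integrable lborel f"
  using integrable_distr_eq[of "(+) c" lborel borel f] lborel_distr_plus[of c] by (simp add: add.commute)

lemma nn_integral_lborel_translation:
  fixes f :: "'a::euclidean_space \<Rightarrow> ennreal"
  assumes [measurable]: "f \<in> borel_measurable borel"
  shows "(\<integral>\<^sup>+x. f (x + c) \<partial>lborel) = (\<integral>\<^sup>+x. f x \<partial>lborel)"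
  using nn_integral_distr[of "(+) c" lborel borel f] lborel_distr_plus[of c] by (simp add: add.commute)

lemma norm_scaleR_le_squares:
  fixes b :: "'b::real_normed_vector"
  shows "norm (a *\<^sub>R b) \<le> a\<^sup>2 + (norm b)\<^sup>2"
proof -
  have "0 \<le> (\<bar>a\<bar> - norm b)\<^sup>2" by simp
  then have "2 * (\<bar>a\<bar> * norm b) \<le> a\<^sup>2 + (norm b)\<^sup>2"
    by (simp add: power2_diff)
  moreover have "0 \<le> \<bar>a\<bar> * norm b" by simp
  ultimately show ?thesis unfolding norm_scaleR by linarith
qed

lemma integrable_scaleR_squares:
  fixes v :: "'a \<Rightarrow> 'b::{banach, second_countable_topology}"
  assumes [measurable]: "\<phi> \<in> borel_measurable M" "v \<in> borel_measurable M"
    and "integrable M (\<lambda>x. (\<phi> x)\<^sup>2)" "integrable M (\<lambda>x. (norm (v x))\<^sup>2)"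
  shows "integrable M (\<lambda>x. \<phi> x *\<^sub>R v x)"
  by (rule Bochner_Integration.integrable_bound[OF Bochner_Integration.integrable_add[OF assms(3,4)]])
     (auto simp: norm_scaleR_le_squares simp del: norm_scaleR)

text \<open>This licenses every exchange of the integral over x with the integral over the shift.
  After |ab| <= a^2 + b^2, translation invariance makes the inner integral independent of
  \<open>s\<close>, and \<open>{0..h}\<close> has finite length. Two shift vectors are allowed
  because the shift sits first on the test function and then on \<open>g\<close>.\<close>

lemma integrable_translated_product:
  fixes \<phi> :: "'a::euclidean_space \<Rightarrow> real" and g :: "'a \<Rightarrow> 'b::{banach, second_countable_topology}"
  assumes [measurable]: "\<phi> \<in> borel_measurable borel" "g \<in> borel_measurable borel"
    and "integrable lborel (\<lambda>x. (\<phi> x)\<^sup>2)" "integrable lborel (\<lambda>x. (norm (g x))\<^sup>2)"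
  shows "integrable (lborel \<Otimes>\<^sub>M lborel)
    (\<lambda>(x, s). indicator {0..h} s *\<^sub>R (\<phi> (x + s *\<^sub>R c) *\<^sub>R g (x + s *\<^sub>R d)))"
    (is "integrable _ ?F")
proof (rule integrableI_bounded)
  show "?F \<in> borel_measurable (lborel \<Otimes>\<^sub>M lborel)" by measurable
  let ?G = "\<lambda>(x, s). indicator {0..h} s * (ennreal ((\<phi> (x + s *\<^sub>R c))\<^sup>2) + ennreal ((norm (g (x + s *\<^sub>R d)))\<^sup>2))"
  have "(\<integral>\<^sup>+z. norm (?F z) \<partial>(lborel \<Otimes>\<^sub>M lborel)) \<le> (\<integral>\<^sup>+z. ?G z \<partial>(lborel \<Otimes>\<^sub>M lborel))"
    by (intro nn_integral_mono) (auto simp: indicator_def norm_scaleR_le_squares simp del: norm_scaleR simp flip: ennreal_plus)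
  also have "\<dots> = (\<integral>\<^sup>+s. \<integral>\<^sup>+x. ?G (x, s) \<partial>lborel \<partial>lborel)"
    by (rule lborel_pair.nn_integral_snd[symmetric]) measurable
  also have "\<dots> = (\<integral>\<^sup>+s. indicator {0..h} s * ((\<integral>\<^sup>+x. (\<phi> x)\<^sup>2 \<partial>lborel) + (\<integral>\<^sup>+x. (norm (g x))\<^sup>2 \<partial>lborel)) \<partial>lborel)"
  proof (intro nn_integral_cong)
    fix s :: real
    have "(\<integral>\<^sup>+x. ?G (x, s) \<partial>lborel) = indicator {0..h} s *
      ((\<integral>\<^sup>+x. (\<phi> (x + s *\<^sub>R c))\<^sup>2 \<partial>lborel) + (\<integral>\<^sup>+x. (norm (g (x + s *\<^sub>R d)))\<^sup>2 \<partial>lborel))"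
      by (simp add: nn_integral_cmult nn_integral_add)
    then show "(\<integral>\<^sup>+x. ?G (x, s) \<partial>lborel) = indicator {0..h} s *
      ((\<integral>\<^sup>+x. (\<phi> x)\<^sup>2 \<partial>lborel) + (\<integral>\<^sup>+x. (norm (g x))\<^sup>2 \<partial>lborel))"
      using nn_integral_lborel_translation[of "\<lambda>x. ennreal ((\<phi> x)\<^sup>2)" "s *\<^sub>R c"]
        nn_integral_lborel_translation[of "\<lambda>x. ennreal ((norm (g x))\<^sup>2)" "s *\<^sub>R d"]
      by simp
  qed
  also have "\<dots> = emeasure lborel {0..h} * ((\<integral>\<^sup>+x. (\<phi> x)\<^sup>2 \<partial>lborel) + (\<integral>\<^sup>+x. (norm (g x))\<^sup>2 \<partial>lborel))"
    by (simp add: nn_integral_multc)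
  also have "\<dots> < \<infinity>"
  proof -
    have "(\<integral>\<^sup>+x. (\<phi> x)\<^sup>2 \<partial>lborel) < \<infinity>" "(\<integral>\<^sup>+x. (norm (g x))\<^sup>2 \<partial>lborel) < \<infinity>"
      using assms(3,4) by (auto simp: integrable_iff_bounded)
    then show ?thesis
      by (auto simp: ennreal_mult_less_top emeasure_lborel_Icc_eq)
  qed
  finally show "(\<integral>\<^sup>+z. norm (?F z) \<partial>(lborel \<Otimes>\<^sub>M lborel)) < \<infinity>" .
qed

lemma integrable_square_prod_fun:
  assumes "\<And>j. bump (b j)"
  shows "integrable lborel (\<lambda>x. (prod_fun b x)\<^sup>2)"
proof -
  obtain R where R: "\<And>x. x \<notin> cbox (\<chi> i. - R) (\<chi> i. R) \<Longrightarrow> prod_fun b x = 0"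
    using prod_fun_support[of b, OF assms] by blast
  have "set_integrable lborel (cbox (\<chi> i. - R) (\<chi> i. R)) (\<lambda>x. (prod_fun b x)\<^sup>2)"
    unfolding set_integrable_def
    by (intro borel_integrable_compact compact_cbox continuous_intros continuous_on_prod_fun assms)
  moreover have "indicator (cbox (\<chi> i. - R) (\<chi> i. R)) x *\<^sub>R (prod_fun b x)\<^sup>2 = (prod_fun b x)\<^sup>2" for x
    using R[of x] by (auto simp: indicator_def)
  ultimately show ?thesis
    by (simp only: set_integrable_def)
qed

lemma borel_measurable_prod_fun:
  assumes "\<And>j. bump (b j)" shows "prod_fun b \<in> borel_measurable borel"
  by (intro borel_measurable_continuous_onI continuous_on_prod_fun assms)

text \<open>The i-th factor of a product test function is replaced by the bump \<open>B\<close> of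
  \<open>bump_shift_antiderivative\<close>. The resulting \<psi> has partial derivative
  \<open>\<phi> x - \<phi> (x - h e)\<close> and is itself the integral of the shifted \<phi> over
  \<open>{0..h}\<close>. Moving the shifts onto \<open>u\<close> and \<open>g\<close> shows that the
  two sides have the same integral against every \<phi>.\<close>

lemma weak_partial_difference:
  fixes u g :: "real ^ 'n::finite \<Rightarrow> complex"
  assumes [measurable]: "u \<in> borel_measurable borel" "g \<in> borel_measurable borel"
    and u2: "integrable lborel (\<lambda>x. (cmod (u x))\<^sup>2)" and g2: "integrable lborel (\<lambda>x. (cmod (g x))\<^sup>2)"
    and weak: "\<And>b. (\<And>j. bump (b j)) \<Longrightarrow>
      (LINT x|lborel. prod_fun (b(i := deriv (b i))) x *\<^sub>R u x) = - (LINT x|lborel. prod_fun b x *\<^sub>R g x)"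
    and h: "0 \<le> h"
  shows "AE x in lborel. u (x + h *\<^sub>R axis i 1) - u x = (LINT s:{0..h}|lborel. g (x + s *\<^sub>R axis i 1))"
proof -
  define e :: "real ^ 'n" where "e = axis i 1"
  define G where "G x = (LINT s:{0..h}|lborel. g (x + s *\<^sub>R e))" for x
  have G_int: "integrable lborel (\<lambda>x. \<phi> x *\<^sub>R G x)"
    and G_swap: "(LINT x|lborel. \<phi> x *\<^sub>R G x) = (LINT s:{0..h}|lborel. LINT x|lborel. \<phi> x *\<^sub>R g (x + s *\<^sub>R e))"
    if [measurable]: "\<phi> \<in> borel_measurable borel" and \<phi>2: "integrable lborel (\<lambda>x. (\<phi> x)\<^sup>2)" for \<phi>
  proof -
    have *: "integrable (lborel \<Otimes>\<^sub>M lborel) (\<lambda>(x, s). indicator {0..h} s *\<^sub>R (\<phi> x *\<^sub>R g (x + s *\<^sub>R e)))"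
      using integrable_translated_product[of \<phi> g h 0 e] g2 \<phi>2 by simp
    have eq: "(LINT s|lborel. indicator {0..h} s *\<^sub>R (\<phi> x *\<^sub>R g (x + s *\<^sub>R e))) = \<phi> x *\<^sub>R G x" for x
      unfolding G_def set_lebesgue_integral_def
      by (subst integral_scaleR_right[symmetric]) (simp add: mult.commute)
    show "integrable lborel (\<lambda>x. \<phi> x *\<^sub>R G x)"
      using lborel_pair.integrable_fst[OF *] unfolding eq .
    show "(LINT x|lborel. \<phi> x *\<^sub>R G x) = (LINT s:{0..h}|lborel. LINT x|lborel. \<phi> x *\<^sub>R g (x + s *\<^sub>R e))"
      using lborel_pair.Fubini_integral[OF *] unfolding eq set_lebesgue_integral_def
      by (simp del: scaleR_scaleR)
  qed
  have prodint: "integrable lborel (\<lambda>x. \<phi> x *\<^sub>R v (x + c))"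
    if [measurable]: "\<phi> \<in> borel_measurable borel" "v \<in> borel_measurable borel"
      and "integrable lborel (\<lambda>x. (\<phi> x)\<^sup>2)" "integrable lborel (\<lambda>x. (cmod (v x))\<^sup>2)" for \<phi> v and c :: "real ^ 'n"
    using that integrable_lborel_translation[of "\<lambda>x. (cmod (v x))\<^sup>2" c]
    by (intro integrable_scaleR_squares) auto
  have "AE x in lborel. u (x + h *\<^sub>R e) - u x - G x = 0"
  proof (rule AE_zero_if_prod_fun_integrals_zero)
    fix a b :: "real ^ 'n"
    have "integrable lborel (\<lambda>x. (indicator (box a b) x :: real)\<^sup>2)"
      using integrable_real_indicator[of "box a b" lborel, OF _ emeasure_lborel_box_finite]
      by (simp add: power2_eq_square indicator_inter_arith[symmetric])
    then show "set_integrable lborel (box a b) (\<lambda>x. u (x + h *\<^sub>R e) - u x - G x)"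
      unfolding set_integrable_def
      using prodint[of "indicator (box a b)" u "h *\<^sub>R e"] prodint[of "indicator (box a b)" u 0] u2
        G_int[of "indicator (box a b)"]
      by (simp add: scaleR_diff_right)
  next
    fix b :: "'n \<Rightarrow> real \<Rightarrow> real"
    assume b: "\<And>j. bump (b j)"
    define \<phi> where "\<phi> = prod_fun b"
    have [measurable]: "\<phi> \<in> borel_measurable borel" and \<phi>2: "integrable lborel (\<lambda>x. (\<phi> x)\<^sup>2)"
      unfolding \<phi>_def by (intro borel_measurable_prod_fun integrable_square_prod_fun b)+
    obtain B where B: "bump B" "\<And>t. deriv B t = b i t - b i (t - h)"
      "\<And>t. ((\<lambda>s. b i (t - s)) has_integral B t) {0..h}"
      using bump_shift_antiderivative[OF b h] by blast
    define \<psi> where "\<psi> = prod_fun (b(i := B))"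
    have shift: "\<phi> (x - s *\<^sub>R e) = b i (x $ i - s) * (\<Prod>j\<in>UNIV - {i}. b j (x $ j))" for x s
      unfolding \<phi>_def prod_fun_split[of _ _ i] by (auto simp: e_def axis_def intro!: prod.cong)
    have d\<psi>: "prod_fun ((b(i := B))(i := deriv ((b(i := B)) i))) x = \<phi> x - \<phi> (x - h *\<^sub>R e)" for x
      using shift[of x 0] shift[of x h] by (simp add: prod_fun_upd B(2) algebra_simps)
    have \<psi>_int: "set_integrable lborel {0..h} (\<lambda>s. \<phi> (x - s *\<^sub>R e))"
      and \<psi>_eq: "\<psi> x = (LINT s:{0..h}|lborel. \<phi> (x - s *\<^sub>R e))" for x
    proof -
      have *: "set_integrable lborel {0..h} (\<lambda>s. b i (x $ i - s))"
        unfolding set_integrable_def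
        by (intro borel_integrable_compact continuous_on_compose2[OF bump_continuous[OF b, of UNIV]] continuous_intros) auto
      then show "set_integrable lborel {0..h} (\<lambda>s. \<phi> (x - s *\<^sub>R e))"
        unfolding shift by simp
      from * have "(LINT s:{0..h}|lborel. b i (x $ i - s)) = B (x $ i)"
        using set_borel_integral_eq_integral(2) B(3) integral_unique by metis
      then show "\<psi> x = (LINT s:{0..h}|lborel. \<phi> (x - s *\<^sub>R e))"
        unfolding shift \<psi>_def by (simp add: prod_fun_upd)
    qed
    have "(LINT x|lborel. \<phi> x *\<^sub>R u (x + h *\<^sub>R e)) = (LINT x|lborel. \<phi> (x - h *\<^sub>R e) *\<^sub>R u x)"
      using integral_lborel_translation[of "\<lambda>x. \<phi> (x - h *\<^sub>R e) *\<^sub>R u x" "h *\<^sub>R e"] by simp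
    moreover have "integrable lborel (\<lambda>x. \<phi> (x - h *\<^sub>R e) *\<^sub>R u x)"
      using integrable_lborel_translation[of "\<lambda>x. \<phi> (x - h *\<^sub>R e) *\<^sub>R u x" "h *\<^sub>R e"]
        prodint[of \<phi> u "h *\<^sub>R e"] u2 \<phi>2 by simp
    moreover have "integrable lborel (\<lambda>x. \<phi> x *\<^sub>R u x)"
      using prodint[of \<phi> u 0] u2 \<phi>2 by simp
    ultimately have "(LINT x|lborel. \<phi> x *\<^sub>R u (x + h *\<^sub>R e)) - (LINT x|lborel. \<phi> x *\<^sub>R u x)
       = - (LINT x|lborel. (\<phi> x - \<phi> (x - h *\<^sub>R e)) *\<^sub>R u x)"
      by (simp add: scaleR_diff_left)
    also have "\<dots> = (LINT x|lborel. \<psi> x *\<^sub>R g x)"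
      using weak[of "b(i := B)"] b B(1) unfolding d\<psi> \<psi>_def by simp
    also have "\<dots> = (LINT x|lborel. LINT s|lborel. indicator {0..h} s *\<^sub>R (\<phi> (x + s *\<^sub>R (- e)) *\<^sub>R g (x + s *\<^sub>R 0)))"
      unfolding \<psi>_eq set_lebesgue_integral_def
      using \<psi>_int by (subst integral_scaleR_left[symmetric]) (simp_all add: set_integrable_def)
    also have "\<dots> = (LINT s|lborel. LINT x|lborel. indicator {0..h} s *\<^sub>R (\<phi> (x + s *\<^sub>R (- e)) *\<^sub>R g (x + s *\<^sub>R 0)))"
      using lborel_pair.Fubini_integral[OF integrable_translated_product[of \<phi> g h "- e" 0]] g2 \<phi>2 by simp
    \<comment> \<open>For each fixed \<open>s\<close> the substitution of x + s e for x takes the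
      shift off the test function and puts it on \<open>g\<close>.\<close>
    also have "\<dots> = (LINT s:{0..h}|lborel. LINT x|lborel. \<phi> x *\<^sub>R g (x + s *\<^sub>R e))"
    proof -
      have "(LINT x|lborel. \<phi> (x - s *\<^sub>R e) *\<^sub>R g x) = (LINT x|lborel. \<phi> x *\<^sub>R g (x + s *\<^sub>R e))" for s
        using integral_lborel_translation[of "\<lambda>x. \<phi> (x - s *\<^sub>R e) *\<^sub>R g x" "s *\<^sub>R e"] by simp
      then show ?thesis by (simp add: set_lebesgue_integral_def del: scaleR_scaleR)
    qed
    also have "\<dots> = (LINT x|lborel. \<phi> x *\<^sub>R G x)"
      using G_swap[of \<phi>] \<phi>2 by simp
    finally have eq: "(LINT x|lborel. \<phi> x *\<^sub>R u (x + h *\<^sub>R e)) - (LINT x|lborel. \<phi> x *\<^sub>R u x)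
      = (LINT x|lborel. \<phi> x *\<^sub>R G x)" .
    have "(LINT x|lborel. prod_fun b x *\<^sub>R (u (x + h *\<^sub>R e) - u x - G x))
      = (LINT x|lborel. \<phi> x *\<^sub>R u (x + h *\<^sub>R e) - \<phi> x *\<^sub>R u x - \<phi> x *\<^sub>R G x)"
      by (simp only: scaleR_diff_right \<phi>_def)
    also have "\<dots> = (LINT x|lborel. \<phi> x *\<^sub>R u (x + h *\<^sub>R e)) - (LINT x|lborel. \<phi> x *\<^sub>R u x) - (LINT x|lborel. \<phi> x *\<^sub>R G x)"
      using prodint[of \<phi> u "h *\<^sub>R e"] prodint[of \<phi> u 0] u2 \<phi>2 G_int[of \<phi>]
      by (subst Bochner_Integration.integral_diff Bochner_Integration.integrable_diff; simp)+
    also have "\<dots> = 0" unfolding eq by simp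
    finally show "(LINT x|lborel. prod_fun b x *\<^sub>R (u (x + h *\<^sub>R e) - u x - G x)) = 0" .
  qed
  then show ?thesis
    unfolding e_def G_def by (auto elim: eventually_mono)
qed

section \<open>Hardy's inequality\<close>

text \<open>A discrete form of integrating (d/de F) |u|^2 by parts and applying Young's inequality.
  A translation moves the difference from \<open>F\<close> to |u|^2, and | |u|^2 - |U|^2 | <= |U -
  u| (|U| + |u|) reduces it to a difference of \<open>u\<close>, which the integral of
  \<open>g\<close> along the segment controls.\<close>

lemma difference_quotient_bound:
  fixes u g :: "'a::euclidean_space \<Rightarrow> complex" and F :: "'a \<Rightarrow> real"
  assumes [measurable]: "u \<in> borel_measurable borel" "g \<in> borel_measurable borel" "F \<in> borel_measurable borel"
    and u2: "integrable lborel (\<lambda>x. (cmod (u x))\<^sup>2)" and g2: "integrable lborel (\<lambda>x. (cmod (g x))\<^sup>2)"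
    and diff: "AE x in lborel. u (x + h *\<^sub>R e) - u x = (LINT s:{0..h}|lborel. g (x + s *\<^sub>R e))"
    and M: "\<And>x. \<bar>F x\<bar> \<le> M" and h: "0 \<le> h"
  shows "(LINT x|lborel. (F x - F (x - h *\<^sub>R e)) * (cmod (u x))\<^sup>2)
    \<le> h * (2 * (LINT x|lborel. (cmod (g x))\<^sup>2)
          + 1 / 4 * (LINT x|lborel. ((F x)\<^sup>2 + (F (x - h *\<^sub>R e))\<^sup>2) * (cmod (u x))\<^sup>2))"
proof -
  define U where "U x = u (x + h *\<^sub>R e)" for x
  have [measurable]: "U \<in> borel_measurable borel" unfolding U_def[abs_def] by measurable
  have U2: "integrable lborel (\<lambda>x. (cmod (U x))\<^sup>2)"
    using integrable_lborel_translation[of "\<lambda>x. (cmod (u x))\<^sup>2" "h *\<^sub>R e"] u2 by (simp add: U_def)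
  have bounded_int: "integrable lborel (\<lambda>x. k x * (cmod (v x))\<^sup>2)"
    if [measurable]: "k \<in> borel_measurable borel" "v \<in> borel_measurable borel"
      and "\<And>x. \<bar>k x\<bar> \<le> C" "integrable lborel (\<lambda>x. (cmod (v x))\<^sup>2)" for k and v :: "'a \<Rightarrow> complex" and C
    by (rule Bochner_Integration.integrable_bound[OF integrable_mult_right[OF that(4), of C]])
       (use that(3) in \<open>auto simp: abs_mult intro!: mult_right_mono order_trans[OF _ abs_ge_self]\<close>)
  have F2: "\<bar>(F x)\<^sup>2\<bar> \<le> M\<^sup>2" for x
    using M[of x] by (simp add: abs_le_square_iff[symmetric])
  define K where "K x = \<bar>F x\<bar> * (cmod (U x) + cmod (u x))" for x
  have [measurable]: "K \<in> borel_measurable borel" unfolding K_def[abs_def] by measurable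
  \<comment> \<open>\<open>Q\<close> majorizes \<open>(K x)^2 / 8\<close>, the remainder of the
    AM-GM step below: (|U| + |u|)^2 <= 2 (|U|^2 + |u|^2) turns 1/8 into 1/4.\<close>
  define Q where "Q x = 1 / 4 * ((F x)\<^sup>2 * (cmod (U x))\<^sup>2 + (F x)\<^sup>2 * (cmod (u x))\<^sup>2)" for x
  have Q_int: "integrable lborel Q"
    unfolding Q_def[abs_def]
    by (intro integrable_mult_right Bochner_Integration.integrable_add bounded_int[OF _ _ F2] u2 U2) auto
  have KQ: "(K x)\<^sup>2 / 8 \<le> Q x" for x
  proof -
    have "(cmod (U x) + cmod (u x))\<^sup>2 \<le> 2 * ((cmod (U x))\<^sup>2 + (cmod (u x))\<^sup>2)"
      using sum_squares_bound[of "cmod (U x)" "cmod (u x)"] by (simp add: power2_sum)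
    then have "(F x)\<^sup>2 * (cmod (U x) + cmod (u x))\<^sup>2 \<le> (F x)\<^sup>2 * (2 * ((cmod (U x))\<^sup>2 + (cmod (u x))\<^sup>2))"
      by (intro mult_left_mono) auto
    moreover have "(K x)\<^sup>2 = (F x)\<^sup>2 * (cmod (U x) + cmod (u x))\<^sup>2"
      by (simp add: K_def power_mult_distrib)
    ultimately show ?thesis
      by (simp add: Q_def distrib_left)
  qed
  have W: "AE x in lborel. ennreal (cmod (U x - u x) * K x)
     \<le> (\<integral>\<^sup>+s. indicator {0..h} s * ennreal (2 * (cmod (g (x + s *\<^sub>R e)))\<^sup>2) \<partial>lborel) + ennreal h * ennreal (Q x)"
    using diff
  proof eventually_elim
    case (elim x)
    have "ennreal (cmod (U x - u x)) \<le> (\<integral>\<^sup>+s. norm (indicator {0..h} s *\<^sub>R g (x + s *\<^sub>R e)) \<partial>lborel)"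
    proof (cases "integrable lborel (\<lambda>s. indicator {0..h} s *\<^sub>R g (x + s *\<^sub>R e))")
      case True
      then show ?thesis
        using integral_norm_bound_ennreal[OF True] elim by (simp add: U_def set_lebesgue_integral_def)
    next
      \<comment> \<open>A divergent Bochner integral is 0, so \<open>elim\<close> forces
        \<open>U x = u x\<close> here and the left-hand side vanishes.\<close>
      case False
      then show ?thesis
        using elim by (simp add: U_def set_lebesgue_integral_def not_integrable_integral_eq)
    qed
    then have "ennreal (cmod (U x - u x) * K x)
        \<le> (\<integral>\<^sup>+s. norm (indicator {0..h} s *\<^sub>R g (x + s *\<^sub>R e)) \<partial>lborel) * ennreal (K x)"
      by (simp add: ennreal_mult K_def mult_right_mono)
    also have "\<dots> = (\<integral>\<^sup>+s. norm (indicator {0..h} s *\<^sub>R g (x + s *\<^sub>R e)) * ennreal (K x) \<partial>lborel)"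
      by (rule nn_integral_multc[symmetric]) measurable
    also have "\<dots> \<le> (\<integral>\<^sup>+s. indicator {0..h} s * ennreal (2 * (cmod (g (x + s *\<^sub>R e)))\<^sup>2)
        + indicator {0..h} s * ennreal (Q x) \<partial>lborel)"
    proof (intro nn_integral_mono)
      fix s
      \<comment> \<open>The weights in this AM-GM step keep only half of the Hardy integral on the right-hand side,
        where it can be absorbed when \<open>N \<ge> 3\<close>.\<close>
      have "a * K x \<le> 2 * a\<^sup>2 + Q x" for a
      proof -
        have "0 \<le> (4 * a - K x)\<^sup>2" by simp
        then have "a * K x \<le> 2 * a\<^sup>2 + (K x)\<^sup>2 / 8"
          by (simp add: power2_eq_square algebra_simps)
        then show ?thesis using KQ[of x] by linarith
      qed
      moreover have "0 \<le> Q x" "0 \<le> K x" by (auto simp: Q_def K_def)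
      ultimately show "norm (indicator {0..h} s *\<^sub>R g (x + s *\<^sub>R e)) * ennreal (K x)
        \<le> indicator {0..h} s * ennreal (2 * (cmod (g (x + s *\<^sub>R e)))\<^sup>2) + indicator {0..h} s * ennreal (Q x)"
        by (auto simp: indicator_def simp flip: ennreal_mult ennreal_plus)
    qed
    also have "\<dots> = (\<integral>\<^sup>+s. indicator {0..h} s * ennreal (2 * (cmod (g (x + s *\<^sub>R e)))\<^sup>2) \<partial>lborel)
        + ennreal h * ennreal (Q x)"
      using h by (subst nn_integral_add) (auto simp: nn_integral_multc)
    finally show ?case .
  qed
  have "(\<integral>\<^sup>+x. ennreal (cmod (U x - u x) * K x) \<partial>lborel)
    \<le> (\<integral>\<^sup>+x. (\<integral>\<^sup>+s. indicator {0..h} s * ennreal (2 * (cmod (g (x + s *\<^sub>R e)))\<^sup>2) \<partial>lborel)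
         + ennreal h * ennreal (Q x) \<partial>lborel)"
    by (rule nn_integral_mono_AE[OF W])
  also have "\<dots> = (\<integral>\<^sup>+x. \<integral>\<^sup>+s. indicator {0..h} s * ennreal (2 * (cmod (g (x + s *\<^sub>R e)))\<^sup>2) \<partial>lborel \<partial>lborel)
     + ennreal h * (\<integral>\<^sup>+x. Q x \<partial>lborel)"
    using Q_int by (subst nn_integral_add) (auto simp: nn_integral_cmult)
  also have "(\<integral>\<^sup>+x. \<integral>\<^sup>+s. indicator {0..h} s * ennreal (2 * (cmod (g (x + s *\<^sub>R e)))\<^sup>2) \<partial>lborel \<partial>lborel)
     = (\<integral>\<^sup>+s. \<integral>\<^sup>+x. indicator {0..h} s * ennreal (2 * (cmod (g (x + s *\<^sub>R e)))\<^sup>2) \<partial>lborel \<partial>lborel)"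
    by (rule lborel_pair.Fubini'[symmetric]) measurable
  also have "\<dots> = (\<integral>\<^sup>+s. indicator {0..h} s * (\<integral>\<^sup>+x. ennreal (2 * (cmod (g x))\<^sup>2) \<partial>lborel) \<partial>lborel)"
  proof (intro nn_integral_cong)
    fix s :: real
    show "(\<integral>\<^sup>+x. indicator {0..h} s * ennreal (2 * (cmod (g (x + s *\<^sub>R e)))\<^sup>2) \<partial>lborel)
      = indicator {0..h} s * (\<integral>\<^sup>+x. ennreal (2 * (cmod (g x))\<^sup>2) \<partial>lborel)"
      using nn_integral_lborel_translation[of "\<lambda>x. ennreal (2 * (cmod (g x))\<^sup>2)" "s *\<^sub>R e"]
      by (simp add: nn_integral_cmult)
  qed
  also have "\<dots> = ennreal h * (\<integral>\<^sup>+x. ennreal (2 * (cmod (g x))\<^sup>2) \<partial>lborel)"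
    using h by (simp add: nn_integral_multc)
  also have "(\<integral>\<^sup>+x. ennreal (2 * (cmod (g x))\<^sup>2) \<partial>lborel) = ennreal (2 * (LINT x|lborel. (cmod (g x))\<^sup>2))"
    using g2 by (subst nn_integral_eq_integral) auto
  also have "(\<integral>\<^sup>+x. Q x \<partial>lborel) = ennreal (LINT x|lborel. Q x)"
    by (rule nn_integral_eq_integral[OF Q_int]) (simp add: Q_def)
  also have "ennreal h * ennreal (2 * (LINT x|lborel. (cmod (g x))\<^sup>2)) + ennreal h * ennreal (LINT x|lborel. Q x)
     = ennreal (h * (2 * (LINT x|lborel. (cmod (g x))\<^sup>2) + (LINT x|lborel. Q x)))"
    using h by (simp add: ennreal_mult[symmetric] ennreal_plus[symmetric] integral_nonneg_AE Q_def distrib_left del: ennreal_plus)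
  finally have W_le: "(\<integral>\<^sup>+x. ennreal (cmod (U x - u x) * K x) \<partial>lborel)
     \<le> ennreal (h * (2 * (LINT x|lborel. (cmod (g x))\<^sup>2) + (LINT x|lborel. Q x)))" .
  have FU: "integrable lborel (\<lambda>x. F x * (cmod (U x))\<^sup>2)" and Fu: "integrable lborel (\<lambda>x. F x * (cmod (u x))\<^sup>2)"
    by (intro bounded_int[OF _ _ M] u2 U2; measurable)+
  have Fsh: "integrable lborel (\<lambda>x. F (x - h *\<^sub>R e) * (cmod (u x))\<^sup>2)"
    and F2sh: "integrable lborel (\<lambda>x. (F (x - h *\<^sub>R e))\<^sup>2 * (cmod (u x))\<^sup>2)"
    and F2u: "integrable lborel (\<lambda>x. (F x)\<^sup>2 * (cmod (u x))\<^sup>2)"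
    and F2U: "integrable lborel (\<lambda>x. (F x)\<^sup>2 * (cmod (U x))\<^sup>2)"
    by (intro bounded_int[OF _ _ M] bounded_int[OF _ _ F2] u2 U2; measurable)+
  have "(LINT x|lborel. (F x - F (x - h *\<^sub>R e)) * (cmod (u x))\<^sup>2)
    = (LINT x|lborel. F x * (cmod (u x))\<^sup>2) - (LINT x|lborel. F (x - h *\<^sub>R e) * (cmod (u x))\<^sup>2)"
    using Fu Fsh by (simp add: left_diff_distrib)
  also have "(LINT x|lborel. F (x - h *\<^sub>R e) * (cmod (u x))\<^sup>2) = (LINT x|lborel. F x * (cmod (U x))\<^sup>2)"
    using integral_lborel_translation[of "\<lambda>x. F (x - h *\<^sub>R e) * (cmod (u x))\<^sup>2" "h *\<^sub>R e"] by (simp add: U_def)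
  also have "(LINT x|lborel. F x * (cmod (u x))\<^sup>2) - (LINT x|lborel. F x * (cmod (U x))\<^sup>2)
     = (LINT x|lborel. F x * (cmod (u x))\<^sup>2 - F x * (cmod (U x))\<^sup>2)"
    using FU Fu by simp
  also have "\<dots> \<le> h * (2 * (LINT x|lborel. (cmod (g x))\<^sup>2) + (LINT x|lborel. Q x))"
  \<comment> \<open>The integrand changes sign, but \<open>ennreal\<close> sends negative values to
    0, so an upper bound for the nonnegative integral of the positive part is enough.\<close>
  proof (rule integral_real_bounded)
    have "F x * (cmod (u x))\<^sup>2 - F x * (cmod (U x))\<^sup>2 \<le> cmod (U x - u x) * K x" for x
    proof -
      have "F x * (cmod (u x))\<^sup>2 - F x * (cmod (U x))\<^sup>2 = F x * (cmod (u x) - cmod (U x)) * (cmod (U x) + cmod (u x))"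
        by (simp add: power2_eq_square algebra_simps)
      also have "\<dots> \<le> \<bar>F x\<bar> * cmod (U x - u x) * (cmod (U x) + cmod (u x))"
      proof (rule mult_right_mono)
        have "F x * (cmod (u x) - cmod (U x)) \<le> \<bar>F x\<bar> * \<bar>cmod (u x) - cmod (U x)\<bar>"
          by (metis abs_ge_self abs_mult)
        also have "\<dots> \<le> \<bar>F x\<bar> * cmod (U x - u x)"
          using norm_triangle_ineq3[of "u x" "U x"] by (intro mult_left_mono) (auto simp: norm_minus_commute)
        finally show "F x * (cmod (u x) - cmod (U x)) \<le> \<bar>F x\<bar> * cmod (U x - u x)" .
      qed simp
      finally show ?thesis by (simp add: K_def ac_simps)
    qed
    then have "(\<integral>\<^sup>+x. ennreal (F x * (cmod (u x))\<^sup>2 - F x * (cmod (U x))\<^sup>2) \<partial>lborel)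
      \<le> (\<integral>\<^sup>+x. ennreal (cmod (U x - u x) * K x) \<partial>lborel)"
      by (intro nn_integral_mono ennreal_leI)
    with W_le show "(\<integral>\<^sup>+x. ennreal (F x * (cmod (u x))\<^sup>2 - F x * (cmod (U x))\<^sup>2) \<partial>lborel)
      \<le> ennreal (h * (2 * (LINT x|lborel. (cmod (g x))\<^sup>2) + (LINT x|lborel. Q x)))" by (rule order_trans[rotated])
    show "0 \<le> h * (2 * (LINT x|lborel. (cmod (g x))\<^sup>2) + (LINT x|lborel. Q x))"
      using h by (auto intro!: mult_nonneg_nonneg add_nonneg_nonneg integral_nonneg_AE simp: Q_def)
  qed
  also have "(LINT x|lborel. Q x) = 1 / 4 * ((LINT x|lborel. (F x)\<^sup>2 * (cmod (U x))\<^sup>2) + (LINT x|lborel. (F x)\<^sup>2 * (cmod (u x))\<^sup>2))"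
    unfolding Q_def using F2u F2U by simp
  also have "(LINT x|lborel. (F x)\<^sup>2 * (cmod (U x))\<^sup>2) = (LINT x|lborel. (F (x - h *\<^sub>R e))\<^sup>2 * (cmod (u x))\<^sup>2)"
    using integral_lborel_translation[of "\<lambda>x. (F (x - h *\<^sub>R e))\<^sup>2 * (cmod (u x))\<^sup>2" "h *\<^sub>R e"] by (simp add: U_def)
  finally show ?thesis
    using F2u F2sh by (simp add: distrib_right add.commute)
qed

text \<open>\<open>difference_quotient_bound\<close> divided by h, in the limit h -> 0. The
  Lipschitz bound dominates the quotients on the left and \<open>M\<close> dominates the squares on
  the right, where the two copies of \<open>F\<close> squared merge and 1/4 becomes 1/2.\<close>

lemma directional_hardy:
  fixes u g :: "'a::euclidean_space \<Rightarrow> complex" and F :: "'a \<Rightarrow> real"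
  assumes [measurable]: "u \<in> borel_measurable borel" "g \<in> borel_measurable borel"
      "F \<in> borel_measurable borel" "F' \<in> borel_measurable borel"
    and u2: "integrable lborel (\<lambda>x. (cmod (u x))\<^sup>2)" and g2: "integrable lborel (\<lambda>x. (cmod (g x))\<^sup>2)"
    and diff: "\<And>h. 0 \<le> h \<Longrightarrow>
      AE x in lborel. u (x + h *\<^sub>R e) - u x = (LINT s:{0..h}|lborel. g (x + s *\<^sub>R e))"
    and M: "\<And>x. \<bar>F x\<bar> \<le> M"
    and L: "\<And>x h. \<bar>F x - F (x - h *\<^sub>R e)\<bar> \<le> L * \<bar>h\<bar>"
    and F': "\<And>x. ((\<lambda>h. F (x + h *\<^sub>R e)) has_real_derivative F' x) (at 0)"
  shows "(LINT x|lborel. F' x * (cmod (u x))\<^sup>2)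
    \<le> 2 * (LINT x|lborel. (cmod (g x))\<^sup>2) + 1 / 2 * (LINT x|lborel. (F x)\<^sup>2 * (cmod (u x))\<^sup>2)"
proof -
  define h where "h n = inverse (real (Suc n))" for n
  have h: "h n > 0" "h \<longlonglongrightarrow> 0" for n
    unfolding h_def using LIMSEQ_inverse_real_of_nat by auto
  have F2: "(F x)\<^sup>2 \<le> M\<^sup>2" for x
    using M[of x] by (simp add: abs_le_square_iff[symmetric])
  have F_lim: "(\<lambda>n. F (x - h n *\<^sub>R e)) \<longlonglongrightarrow> F x" for x
  proof (rule LIM_zero_cancel, rule Lim_null_comparison)
    show "\<forall>\<^sub>F n in sequentially. norm (F (x - h n *\<^sub>R e) - F x) \<le> L * \<bar>h n\<bar>"
      using L[of x] by (auto simp: abs_minus_commute)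
    show "(\<lambda>n. L * \<bar>h n\<bar>) \<longlonglongrightarrow> 0"
      using tendsto_mult_right_zero[OF tendsto_rabs_zero[OF h(2)]] .
  qed
  have F'_lim: "(\<lambda>n. (F x - F (x - h n *\<^sub>R e)) / h n) \<longlonglongrightarrow> F' x" for x
  proof -
    have "((\<lambda>k. (F (x + (0 + k) *\<^sub>R e) - F (x + 0 *\<^sub>R e)) / k) \<longlongrightarrow> F' x) (at 0)"
      using F'[of x] unfolding DERIV_def by simp
    \<comment> \<open>The quotients look backward from \<open>x\<close>, so the derivative is
      evaluated along the increments \<open>- h n\<close>.\<close>
    moreover have "filterlim (\<lambda>n. - h n) (at 0) sequentially"
      unfolding filterlim_at using tendsto_minus[OF h(2)] h(1) by (auto simp: less_imp_neq[symmetric])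
    ultimately have "(\<lambda>n. (F (x + (0 + - h n) *\<^sub>R e) - F (x + 0 *\<^sub>R e)) / - h n) \<longlonglongrightarrow> F' x"
      by (rule filterlim_compose)
    then show ?thesis by (simp add: minus_divide_left)
  qed
  have "(\<lambda>n. LINT x|lborel. (F x - F (x - h n *\<^sub>R e)) / h n * (cmod (u x))\<^sup>2)
      \<longlonglongrightarrow> (LINT x|lborel. F' x * (cmod (u x))\<^sup>2)"
  proof (rule integral_dominated_convergence)
    show "integrable lborel (\<lambda>x. L * (cmod (u x))\<^sup>2)" using u2 by simp
    show "AE x in lborel. (\<lambda>n. (F x - F (x - h n *\<^sub>R e)) / h n * (cmod (u x))\<^sup>2) \<longlonglongrightarrow> F' x * (cmod (u x))\<^sup>2"
      by (intro AE_I2 tendsto_mult F'_lim tendsto_const)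
    have "\<bar>(F x - F (x - h n *\<^sub>R e)) / h n\<bar> \<le> L" for n x
      using L[of x "h n"] h(1)[of n] by (simp add: pos_divide_le_eq)
    then show "AE x in lborel. norm ((F x - F (x - h n *\<^sub>R e)) / h n * (cmod (u x))\<^sup>2) \<le> L * (cmod (u x))\<^sup>2" for n
      unfolding real_norm_def abs_mult abs_power2 by (intro AE_I2 mult_right_mono) auto
  qed measurable
  moreover have "(\<lambda>n. 2 * (LINT x|lborel. (cmod (g x))\<^sup>2)
          + 1 / 4 * (LINT x|lborel. ((F x)\<^sup>2 + (F (x - h n *\<^sub>R e))\<^sup>2) * (cmod (u x))\<^sup>2))
     \<longlonglongrightarrow> 2 * (LINT x|lborel. (cmod (g x))\<^sup>2)
          + 1 / 4 * (LINT x|lborel. ((F x)\<^sup>2 + (F x)\<^sup>2) * (cmod (u x))\<^sup>2)"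
  proof (intro tendsto_intros integral_dominated_convergence)
    show "integrable lborel (\<lambda>x. (M\<^sup>2 + M\<^sup>2) * (cmod (u x))\<^sup>2)" using u2 by simp
    show "AE x in lborel. (\<lambda>n. ((F x)\<^sup>2 + (F (x - h n *\<^sub>R e))\<^sup>2) * (cmod (u x))\<^sup>2)
      \<longlonglongrightarrow> ((F x)\<^sup>2 + (F x)\<^sup>2) * (cmod (u x))\<^sup>2"
      by (intro AE_I2 tendsto_intros F_lim)
    show "AE x in lborel. norm (((F x)\<^sup>2 + (F (x - h n *\<^sub>R e))\<^sup>2) * (cmod (u x))\<^sup>2)
      \<le> (M\<^sup>2 + M\<^sup>2) * (cmod (u x))\<^sup>2" for n
      unfolding real_norm_def abs_mult abs_power2
      by (intro AE_I2 mult_right_mono) (auto intro: add_mono[OF F2 F2, simplified])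
  qed measurable
  moreover have "(LINT x|lborel. (F x - F (x - h n *\<^sub>R e)) / h n * (cmod (u x))\<^sup>2)
     \<le> 2 * (LINT x|lborel. (cmod (g x))\<^sup>2)
          + 1 / 4 * (LINT x|lborel. ((F x)\<^sup>2 + (F (x - h n *\<^sub>R e))\<^sup>2) * (cmod (u x))\<^sup>2)" for n
  proof -
    have "(LINT x|lborel. (F x - F (x - h n *\<^sub>R e)) / h n * (cmod (u x))\<^sup>2)
      = (LINT x|lborel. (F x - F (x - h n *\<^sub>R e)) * (cmod (u x))\<^sup>2) / h n"
      by (subst integral_divide_zero[symmetric]) simp
    moreover have "(LINT x|lborel. (F x - F (x - h n *\<^sub>R e)) * (cmod (u x))\<^sup>2)
      \<le> h n * (2 * (LINT x|lborel. (cmod (g x))\<^sup>2)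
          + 1 / 4 * (LINT x|lborel. ((F x)\<^sup>2 + (F (x - h n *\<^sub>R e))\<^sup>2) * (cmod (u x))\<^sup>2))"
      using h(1)[of n] by (intro difference_quotient_bound[where M = M] u2 g2 diff M) auto
    ultimately show ?thesis
      using h(1)[of n] by (simp add: pos_divide_le_eq mult.commute)
  qed
  ultimately have "(LINT x|lborel. F' x * (cmod (u x))\<^sup>2) \<le> 2 * (LINT x|lborel. (cmod (g x))\<^sup>2)
          + 1 / 4 * (LINT x|lborel. ((F x)\<^sup>2 + (F x)\<^sup>2) * (cmod (u x))\<^sup>2)"
    by (intro LIMSEQ_le) auto
  also have "(LINT x|lborel. ((F x)\<^sup>2 + (F x)\<^sup>2) * (cmod (u x))\<^sup>2) = 2 * (LINT x|lborel. (F x)\<^sup>2 * (cmod (u x))\<^sup>2)"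
    by (subst integral_mult_right_zero[symmetric]) (simp add: mult.assoc)
  finally show ?thesis by simp
qed

text \<open>This is the profile of one component of the Hardy field along its own axis, with
  \<open>b\<close> collecting \<epsilon> and the squares of the other coordinates. Its slope (b -
  t^2) / (t^2 + b)^2 is at most 1/b in absolute value; the proof uses the corresponding exact
  formula for differences.\<close>

lemma hardy_kernel_lipschitz:
  fixes s t b :: real
  assumes b: "0 < b"
  shows "\<bar>t / (t\<^sup>2 + b) - s / (s\<^sup>2 + b)\<bar> \<le> 1 / b * \<bar>t - s\<bar>"
proof -
  have pos: "0 < t\<^sup>2 + b" "0 < s\<^sup>2 + b"
    using b by (simp_all add: add_nonneg_pos)
  then have "t / (t\<^sup>2 + b) - s / (s\<^sup>2 + b) = (b - t * s) * (t - s) / ((t\<^sup>2 + b) * (s\<^sup>2 + b))"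
    using b by (simp add: field_simps power2_eq_square)
  then have "\<bar>t / (t\<^sup>2 + b) - s / (s\<^sup>2 + b)\<bar> = \<bar>b - t * s\<bar> / ((t\<^sup>2 + b) * (s\<^sup>2 + b)) * \<bar>t - s\<bar>"
    using pos by (simp add: abs_mult)
  also have "\<dots> \<le> 1 / b * \<bar>t - s\<bar>"
  proof (rule mult_right_mono)
    have "0 \<le> (t - s)\<^sup>2" "0 \<le> (t + s)\<^sup>2" by auto
    then have "2 * (t * s) \<le> t\<^sup>2 + s\<^sup>2" "- (2 * (t * s)) \<le> t\<^sup>2 + s\<^sup>2"
      unfolding power2_diff power2_sum by linarith+
    then have "\<bar>b - t * s\<bar> \<le> b + t\<^sup>2 + s\<^sup>2"
      using b zero_le_power2[of t] zero_le_power2[of s] by linarith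
    then have "\<bar>b - t * s\<bar> * b \<le> (b + t\<^sup>2 + s\<^sup>2) * b"
      using b by (intro mult_right_mono) auto
    also have "\<dots> \<le> (t\<^sup>2 + b) * (s\<^sup>2 + b)"
      using zero_le_power2[of "t * s"] by (simp add: algebra_simps power2_eq_square)
    finally show "\<bar>b - t * s\<bar> / ((t\<^sup>2 + b) * (s\<^sup>2 + b)) \<le> 1 / b"
      using b pos by (simp add: divide_le_eq pos_le_divide_eq)
  qed simp
  finally show ?thesis .
qed

text \<open>The directional inequalities are summed over the axes. The sum of the
  \<open>F' i\<close> is the divergence of the field, at least 1/R, and the sum of the squares of
  the \<open>F i\<close> is at most 1/R. With \<open>I\<close> the left-hand integral and G the sum
  of the integrals of |g i|^2 this reads I <= 2 G + I/2, hence the constant 4.\<close>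

lemma regularized_hardy:
  fixes u :: "real ^ 'n::finite \<Rightarrow> complex" and g :: "'n \<Rightarrow> real ^ 'n \<Rightarrow> complex"
  assumes N: "CARD('n) \<ge> 3" and \<epsilon>: "\<epsilon> > 0"
    and [measurable]: "u \<in> borel_measurable borel" "\<And>i. g i \<in> borel_measurable borel"
    and u2: "integrable lborel (\<lambda>x. (cmod (u x))\<^sup>2)" and g2: "\<And>i. integrable lborel (\<lambda>x. (cmod (g i x))\<^sup>2)"
    and diff: "\<And>h i. 0 \<le> h \<Longrightarrow>
      AE x in lborel. u (x + h *\<^sub>R axis i 1) - u x = (LINT s:{0..h}|lborel. g i (x + s *\<^sub>R axis i 1))"
  shows "(LINT x|lborel. (cmod (u x))\<^sup>2 / ((norm (x - a))\<^sup>2 + \<epsilon>))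
    \<le> 4 * (\<Sum>i\<in>UNIV. LINT x|lborel. (cmod (g i x))\<^sup>2)"
proof -
  define R where "R x = (norm (x - a))\<^sup>2 + \<epsilon>" for x
  define F where "F i x = (x $ i - a $ i) / R x" for i x
  define F' where "F' i x = (R x - 2 * (x $ i - a $ i)\<^sup>2) / (R x)\<^sup>2" for i x
  have [measurable]: "R \<in> borel_measurable borel" unfolding R_def[abs_def] by measurable
  have [measurable]: "F i \<in> borel_measurable borel" "F' i \<in> borel_measurable borel" for i
    unfolding F_def[abs_def] F'_def[abs_def] by measurable
  have R_pos: "R x > 0" "R x \<ge> \<epsilon>" for x using \<epsilon> by (auto simp: R_def add_nonneg_pos)
  have norm_sq: "(norm v)\<^sup>2 = (\<Sum>j\<in>UNIV. (v $ j)\<^sup>2)" for v :: "real ^ 'n"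
    by (simp add: norm_vec_def L2_set_def sum_nonneg)
  \<comment> \<open>\<open>rest i\<close> is the part of \<open>R\<close> that stays constant along
    the i-th axis; it is bounded below by \<epsilon>, which makes the Lipschitz constant
    uniform.\<close>
  define rest where "rest i x = (\<Sum>j\<in>UNIV - {i}. ((x - a) $ j)\<^sup>2) + \<epsilon>" for i :: 'n and x
  have rest: "rest i x \<ge> \<epsilon>" "rest i x > 0" for i x
    using \<epsilon> by (auto simp: rest_def sum_nonneg add_nonneg_pos)
  have R_line: "R (x + t *\<^sub>R axis i 1) = (x $ i - a $ i + t)\<^sup>2 + rest i x" for x t i
  proof -
    have "(\<Sum>j\<in>UNIV - {i}. ((x + t *\<^sub>R axis i 1 - a) $ j)\<^sup>2) = (\<Sum>j\<in>UNIV - {i}. ((x - a) $ j)\<^sup>2)"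
      by (intro sum.cong) (auto simp: axis_def)
    then show ?thesis
      unfolding R_def norm_sq rest_def by (simp add: sum.remove[of UNIV i] axis_def algebra_simps)
  qed
  have F_line: "F i (x + t *\<^sub>R axis i 1) = (x $ i - a $ i + t) / ((x $ i - a $ i + t)\<^sup>2 + rest i x)" for x t i
    unfolding F_def R_line by (simp add: axis_def algebra_simps)
  have F2: "(\<Sum>i\<in>UNIV. (F i x)\<^sup>2) \<le> 1 / R x" for x
  proof -
    have "(\<Sum>i\<in>UNIV. (F i x)\<^sup>2) = (norm (x - a))\<^sup>2 / (R x)\<^sup>2"
      unfolding F_def norm_sq by (simp add: power_divide sum_divide_distrib)
    also have "\<dots> \<le> R x / (R x)\<^sup>2"
      using \<epsilon> by (intro divide_right_mono) (auto simp: R_def)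
    finally show ?thesis using R_pos(1)[of x] by (simp add: power2_eq_square)
  qed
  have "(F i x)\<^sup>2 \<le> 1 / \<epsilon>" for i x
  proof -
    have "(F i x)\<^sup>2 \<le> (\<Sum>i\<in>UNIV. (F i x)\<^sup>2)" by (intro member_le_sum) auto
    also have "\<dots> \<le> 1 / R x" by (rule F2)
    also have "\<dots> \<le> 1 / \<epsilon>" using R_pos \<epsilon> by (intro divide_left_mono mult_pos_pos) auto
    finally show ?thesis .
  qed
  then have F_bound: "\<bar>F i x\<bar> \<le> sqrt (1 / \<epsilon>)" for i x
    by (metis real_sqrt_abs real_sqrt_le_mono)
  have F'_bound: "\<bar>F' i x\<bar> \<le> 3 / \<epsilon>" for i x
  proof -
    have "(x $ i - a $ i)\<^sup>2 \<le> R x"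
      using R_line[of x 0 i] rest(2)[of i x] by simp
    then have "\<bar>R x - 2 * (x $ i - a $ i)\<^sup>2\<bar> \<le> 3 * R x"
      using R_pos(1)[of x] zero_le_power2[of "x $ i - a $ i"] by linarith
    then have "\<bar>F' i x\<bar> \<le> 3 * R x / (R x)\<^sup>2"
      unfolding F'_def by (simp add: divide_right_mono)
    also have "\<dots> = 3 / R x" using R_pos(1)[of x] by (simp add: power2_eq_square)
    also have "\<dots> \<le> 3 / \<epsilon>" using R_pos \<epsilon> by (intro divide_left_mono mult_pos_pos) auto
    finally show ?thesis .
  qed
  have dir: "(LINT x|lborel. F' i x * (cmod (u x))\<^sup>2)
    \<le> 2 * (LINT x|lborel. (cmod (g i x))\<^sup>2) + 1 / 2 * (LINT x|lborel. (F i x)\<^sup>2 * (cmod (u x))\<^sup>2)" for i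
  proof (rule directional_hardy[OF _ _ _ _ u2 g2 diff F_bound])
    fix x :: "real ^ 'n" and h :: real
    have "\<bar>F i x - F i (x - h *\<^sub>R axis i 1)\<bar> \<le> 1 / rest i x * \<bar>h\<bar>"
      using hardy_kernel_lipschitz[OF rest(2)[of i x], of "x $ i - a $ i" "x $ i - a $ i - h"]
        F_line[of i x 0] F_line[of i x "- h"] by simp
    also have "\<dots> \<le> 1 / \<epsilon> * \<bar>h\<bar>"
      using rest(1)[of i x] \<epsilon> by (intro mult_right_mono divide_left_mono) auto
    finally show "\<bar>F i x - F i (x - h *\<^sub>R axis i 1)\<bar> \<le> 1 / \<epsilon> * \<bar>h\<bar>" .
  next
    fix x :: "real ^ 'n"
    have "(x $ i - a $ i)\<^sup>2 + rest i x = R x" using R_line[of x 0 i] by simp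
    then show "((\<lambda>h. F i (x + h *\<^sub>R axis i 1)) has_real_derivative F' i x) (at 0)"
      unfolding F_line F'_def using R_pos(1)[of x]
      by (auto intro!: derivative_eq_intros simp: power2_eq_square)
  qed measurable
  have bounded_int: "integrable lborel (\<lambda>x. k x * (cmod (u x))\<^sup>2)"
    if [measurable]: "k \<in> borel_measurable borel" and "\<And>x. \<bar>k x\<bar> \<le> C" for k C
    by (rule Bochner_Integration.integrable_bound[OF integrable_mult_right[OF u2, of C]])
       (use that(2) in \<open>auto simp: abs_mult intro!: mult_right_mono order_trans[OF _ abs_ge_self]\<close>)
  have F2_int: "integrable lborel (\<lambda>x. (F i x)\<^sup>2 * (cmod (u x))\<^sup>2)" for i
    using \<open>\<And>i x. (F i x)\<^sup>2 \<le> 1 / \<epsilon>\<close> by (intro bounded_int[where C = "1 / \<epsilon>"]) auto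
  have F'_int: "integrable lborel (\<lambda>x. F' i x * (cmod (u x))\<^sup>2)" for i
    by (intro bounded_int[OF _ F'_bound]) auto
  \<comment> \<open>Because 1/R <= 1/\<epsilon>, the integral \<open>I\<close> is finite, so half of
    it can be absorbed into the left-hand side.\<close>
  have I_int: "integrable lborel (\<lambda>x. 1 / R x * (cmod (u x))\<^sup>2)"
  proof (rule bounded_int)
    show "\<bar>1 / R x\<bar> \<le> 1 / \<epsilon>" for x
      using R_pos[of x] \<epsilon> by (simp add: frac_le)
  qed measurable
  define I where "I = (LINT x|lborel. 1 / R x * (cmod (u x))\<^sup>2)"
  have "I \<le> (LINT x|lborel. (\<Sum>i\<in>UNIV. F' i x * (cmod (u x))\<^sup>2))"
    unfolding I_def
  proof (rule integral_mono[OF I_int])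
    fix x
    have "(\<Sum>i\<in>UNIV. F' i x) = (real CARD('n) * R x - 2 * (norm (x - a))\<^sup>2) / (R x)\<^sup>2"
      unfolding F'_def norm_sq
      by (simp add: sum_divide_distrib[symmetric] sum_subtractf sum_distrib_left[symmetric])
    \<comment> \<open>Here N >= 3 enters: 3 R - 2 |x - a|^2 = R + 2 \<epsilon>.\<close>
    moreover have "R x \<le> real CARD('n) * R x - 2 * (norm (x - a))\<^sup>2"
    proof -
      have "3 * R x \<le> real CARD('n) * R x"
        using N R_pos(1)[of x] by (intro mult_right_mono) auto
      then show ?thesis using \<epsilon> by (simp add: R_def)
    qed
    ultimately have "R x / (R x)\<^sup>2 \<le> (\<Sum>i\<in>UNIV. F' i x)"
      by (simp add: divide_right_mono)
    then have "1 / R x \<le> (\<Sum>i\<in>UNIV. F' i x)"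
      using R_pos(1)[of x] by (simp add: power2_eq_square)
    then show "1 / R x * (cmod (u x))\<^sup>2 \<le> (\<Sum>i\<in>UNIV. F' i x * (cmod (u x))\<^sup>2)"
      unfolding sum_distrib_right[symmetric] by (intro mult_right_mono) auto
  qed (use F'_int in auto)
  also have "\<dots> = (\<Sum>i\<in>UNIV. LINT x|lborel. F' i x * (cmod (u x))\<^sup>2)"
    using F'_int by (intro Bochner_Integration.integral_sum) auto
  also have "\<dots> \<le> (\<Sum>i\<in>UNIV. 2 * (LINT x|lborel. (cmod (g i x))\<^sup>2) + 1 / 2 * (LINT x|lborel. (F i x)\<^sup>2 * (cmod (u x))\<^sup>2))"
    by (intro sum_mono dir)
  also have "\<dots> = 2 * (\<Sum>i\<in>UNIV. LINT x|lborel. (cmod (g i x))\<^sup>2)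
      + 1 / 2 * (\<Sum>i\<in>UNIV. LINT x|lborel. (F i x)\<^sup>2 * (cmod (u x))\<^sup>2)"
    by (simp add: sum.distrib sum_distrib_left)
  also have "(\<Sum>i\<in>UNIV. LINT x|lborel. (F i x)\<^sup>2 * (cmod (u x))\<^sup>2)
      = (LINT x|lborel. (\<Sum>i\<in>UNIV. (F i x)\<^sup>2) * (cmod (u x))\<^sup>2)"
    using F2_int by (subst Bochner_Integration.integral_sum[symmetric]) (auto simp: sum_distrib_right)
  finally have "I \<le> 2 * (\<Sum>i\<in>UNIV. LINT x|lborel. (cmod (g i x))\<^sup>2)
      + 1 / 2 * (LINT x|lborel. (\<Sum>i\<in>UNIV. (F i x)\<^sup>2) * (cmod (u x))\<^sup>2)" .
  moreover have "(LINT x|lborel. (\<Sum>i\<in>UNIV. (F i x)\<^sup>2) * (cmod (u x))\<^sup>2) \<le> I"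
    unfolding I_def
  proof (rule integral_mono[OF _ I_int])
    show "integrable lborel (\<lambda>x. (\<Sum>i\<in>UNIV. (F i x)\<^sup>2) * (cmod (u x))\<^sup>2)"
      using F2_int by (simp add: sum_distrib_right)
  qed (intro mult_right_mono F2, auto)
  ultimately have "I \<le> 4 * (\<Sum>i\<in>UNIV. LINT x|lborel. (cmod (g i x))\<^sup>2)" by simp
  then show ?thesis by (simp add: I_def R_def)
qed

text \<open>Fatou's lemma with \<epsilon> = 1/(n + 1) in \<open>regularized_hardy\<close>. Stating
  it for the nonnegative integral makes finiteness of the singular integral part of the
  conclusion.\<close>

lemma hardy:
  fixes u :: "real ^ 'n::finite \<Rightarrow> complex" and g :: "'n \<Rightarrow> real ^ 'n \<Rightarrow> complex"
  assumes N: "CARD('n) \<ge> 3"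
    and [measurable]: "u \<in> borel_measurable borel" "\<And>i. g i \<in> borel_measurable borel"
    and u2: "integrable lborel (\<lambda>x. (cmod (u x))\<^sup>2)" and g2: "\<And>i. integrable lborel (\<lambda>x. (cmod (g i x))\<^sup>2)"
    and diff: "\<And>h i. 0 \<le> h \<Longrightarrow>
      AE x in lborel. u (x + h *\<^sub>R axis i 1) - u x = (LINT s:{0..h}|lborel. g i (x + s *\<^sub>R axis i 1))"
  shows "(\<integral>\<^sup>+x. (cmod (u x))\<^sup>2 / (norm (x - a))\<^sup>2 \<partial>lborel)
    \<le> ennreal (4 * (\<Sum>i\<in>UNIV. LINT x|lborel. (cmod (g i x))\<^sup>2))"
proof -
  define f where "f n x = (cmod (u x))\<^sup>2 / ((norm (x - a))\<^sup>2 + inverse (real (Suc n)))" for n x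
  have pos: "(norm (x - a))\<^sup>2 + inverse (real (Suc n)) > 0" for x n
    by (intro add_nonneg_pos) auto
  have [measurable]: "f n \<in> borel_measurable borel" for n
    unfolding f_def[abs_def] by measurable
  have f_int: "integrable lborel (f n)" for n
  proof (rule Bochner_Integration.integrable_bound[OF integrable_mult_right[OF u2, of "real (Suc n)"]])
    have "norm (f n x) \<le> norm (real (Suc n) * (cmod (u x))\<^sup>2)" for x
    proof -
      have "f n x \<le> (cmod (u x))\<^sup>2 / inverse (real (Suc n))"
        unfolding f_def using pos[of x n] by (intro divide_left_mono) auto
      moreover have "0 \<le> f n x" unfolding f_def using pos[of x n] by (intro divide_nonneg_pos) auto
      ultimately show ?thesis by (simp add: divide_inverse mult.commute)
    qed
    then show "AE x in lborel. norm (f n x) \<le> norm (real (Suc n) * (cmod (u x))\<^sup>2)" by simp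
  qed measurable
  have "ennreal ((cmod (u x))\<^sup>2 / (norm (x - a))\<^sup>2) \<le> liminf (\<lambda>n. ennreal (f n x))" for x
  \<comment> \<open>At \<open>x = a\<close> the left-hand side is 0, because division by zero gives
    0.\<close>
  proof (cases "x = a")
    case False
    have "(\<lambda>n. f n x) \<longlonglongrightarrow> (cmod (u x))\<^sup>2 / ((norm (x - a))\<^sup>2 + 0)"
      unfolding f_def using False by (intro tendsto_intros LIMSEQ_inverse_real_of_nat) auto
    then have "(\<lambda>n. ennreal (f n x)) \<longlonglongrightarrow> ennreal ((cmod (u x))\<^sup>2 / (norm (x - a))\<^sup>2)"
      by (intro tendsto_ennrealI) simp
    then show ?thesis using lim_imp_Liminf[of sequentially] by fastforce
  qed simp
  then have "(\<integral>\<^sup>+x. (cmod (u x))\<^sup>2 / (norm (x - a))\<^sup>2 \<partial>lborel) \<le> (\<integral>\<^sup>+x. liminf (\<lambda>n. ennreal (f n x)) \<partial>lborel)"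
    by (intro nn_integral_mono) simp
  also have "\<dots> \<le> liminf (\<lambda>n. \<integral>\<^sup>+x. f n x \<partial>lborel)"
    by (rule nn_integral_liminf) measurable
  also have "\<dots> \<le> liminf (\<lambda>n::nat. ennreal (4 * (\<Sum>i\<in>UNIV. LINT x|lborel. (cmod (g i x))\<^sup>2)))"
  proof (intro Liminf_mono always_eventually allI)
    fix n
    have "(\<integral>\<^sup>+x. f n x \<partial>lborel) = ennreal (LINT x|lborel. f n x)"
    proof (rule nn_integral_eq_integral[OF f_int])
      show "AE x in lborel. 0 \<le> f n x"
        unfolding f_def using pos by (intro AE_I2 divide_nonneg_pos) auto
    qed
    also have "\<dots> \<le> ennreal (4 * (\<Sum>i\<in>UNIV. LINT x|lborel. (cmod (g i x))\<^sup>2))"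
      unfolding f_def by (intro ennreal_leI regularized_hardy N u2 g2 diff) auto
    finally show "(\<integral>\<^sup>+x. f n x \<partial>lborel) \<le> ennreal (4 * (\<Sum>i\<in>UNIV. LINT x|lborel. (cmod (g i x))\<^sup>2))" .
  qed
  also have "\<dots> = ennreal (4 * (\<Sum>i\<in>UNIV. LINT x|lborel. (cmod (g i x))\<^sup>2))"
    by (simp add: Liminf_const)
  finally show ?thesis .
qed

section \<open>Positivity of the energy\<close>

lemma integral_lebesgue_eq_lborel:
  fixes f f' :: "'a::euclidean_space \<Rightarrow> 'b::{banach, second_countable_topology}"
  assumes "f \<in> borel_measurable lebesgue" "f' \<in> borel_measurable borel" "AE x in lborel. f x = f' x"
  shows "(LINT x|lebesgue. f x) = (LINT x|lborel. f' x)"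
proof -
  have f': "f' \<in> borel_measurable lebesgue"
    using assms(2) by (intro measurable_completion) simp
  have "(LINT x|lebesgue. f x) = (LINT x|lebesgue. f' x)"
    using assms f' by (intro integral_cong_AE AE_completion) auto
  also have "\<dots> = (LINT x|lborel. f' x)"
    using assms by (intro integral_completion) auto
  finally show ?thesis .
qed

lemma integrable_lebesgue_iff_lborel:
  fixes f f' :: "'a::euclidean_space \<Rightarrow> 'b::{banach, second_countable_topology}"
  assumes "f \<in> borel_measurable lebesgue" "f' \<in> borel_measurable borel" "AE x in lborel. f x = f' x"
  shows "integrable lebesgue f \<longleftrightarrow> integrable lborel f'"
proof -
  have f': "f' \<in> borel_measurable lebesgue"
    using assms(2) by (intro measurable_completion) simp
  have "integrable lebesgue f \<longleftrightarrow> integrable lebesgue f'"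
    using assms f' by (intro integrable_cong_AE AE_completion) auto
  also have "\<dots> \<longleftrightarrow> integrable lborel f'"
    using assms by (intro integrable_completion) auto
  finally show ?thesis .
qed

lemma lebesgue_measurable_borel_representative:
  fixes u :: "'a::euclidean_space \<Rightarrow> complex"
  assumes "u \<in> borel_measurable lebesgue"
  obtains v where "v \<in> borel_measurable borel" "AE x in lborel. u x = v x"
proof -
  obtain v where v: "v \<in> borel_measurable lborel" "AE x in lborel. u x = v x"
    using complex_ex_borel_measurable[OF assms] by (rule bexE)
  from v(1) have "v \<in> borel_measurable borel" by simp
  then show ?thesis using v(2) by (rule that)
qed

text \<open>The truncations to growing balls are integrable, hence measurable, and at each point
  they eventually equal \<open>g\<close>. This is how measurability reaches
  \<open>weak_partial\<close>, of which the choice guarantees only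
  \<open>is_weak_partial\<close>.\<close>

lemma locally_integrable_measurable:
  fixes g :: "real ^ 'n::finite \<Rightarrow> complex"
  assumes "locally_integrable g" shows "g \<in> borel_measurable lebesgue"
proof (rule borel_measurable_LIMSEQ_metric)
  fix n :: nat
  have "set_integrable lebesgue (cball 0 (real n)) g"
    using assms by (simp add: locally_integrable_def)
  then show "(\<lambda>x. indicator (cball 0 (real n)) x *\<^sub>R g x) \<in> borel_measurable lebesgue"
    unfolding set_integrable_def by (rule borel_measurable_integrable)
next
  fix x :: "real ^ 'n"
  have "\<forall>\<^sub>F n in sequentially. real n \<ge> norm x"
    using filterlim_real_sequentially by (simp add: filterlim_at_top)
  then have "\<forall>\<^sub>F n in sequentially. g x = indicator (cball 0 (real n)) x *\<^sub>R g x"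
    by eventually_elim simp
  then show "(\<lambda>n. indicator (cball 0 (real n)) x *\<^sub>R g x) \<longlonglongrightarrow> g x"
    by (rule Lim_transform_eventually[OF tendsto_const])
qed

lemma integrable_prod_fun_locally_integrable:
  fixes g :: "real ^ 'n::finite \<Rightarrow> complex"
  assumes b: "\<And>j. bump (b j)" and g: "locally_integrable g"
  shows "integrable lebesgue (\<lambda>x. prod_fun b x *\<^sub>R g x)"
proof -
  obtain R where R: "\<And>x. x \<notin> cbox (\<chi> i. - R) (\<chi> i. R) \<Longrightarrow> prod_fun b x = 0"
    using prod_fun_support[of b, OF b] by blast
  let ?K = "cbox (\<chi> i. - R) (\<chi> i. R) :: (real ^ 'n) set"
  have "compact (prod_fun b ` ?K)"
    by (intro compact_continuous_image continuous_on_prod_fun b compact_cbox)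
  then obtain M where M: "\<And>x. x \<in> ?K \<Longrightarrow> \<bar>prod_fun b x\<bar> \<le> M"
    by (meson compact_imp_bounded bounded_real imageI)
  have "set_integrable lebesgue ?K g"
    using g by (simp add: locally_integrable_def)
  then have int: "integrable lebesgue (\<lambda>x. M *\<^sub>R (indicator ?K x *\<^sub>R g x))"
    unfolding set_integrable_def by (rule integrable_scaleR_right)
  have [measurable]: "g \<in> borel_measurable lebesgue" "prod_fun b \<in> borel_measurable lebesgue"
    using locally_integrable_measurable[OF g] borel_measurable_prod_fun[of b, OF b]
    by (auto intro: measurable_completion)
  show ?thesis
  proof (rule Bochner_Integration.integrable_bound[OF int])
    have "norm (prod_fun b x *\<^sub>R g x) \<le> norm (M *\<^sub>R (indicator ?K x *\<^sub>R g x))" for x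
      using R[of x] M[of x] by (cases "x \<in> ?K") (auto intro!: mult_right_mono)
    then show "AE x in lebesgue. norm (prod_fun b x *\<^sub>R g x) \<le> norm (M *\<^sub>R (indicator ?K x *\<^sub>R g x))"
      by simp
  qed measurable
qed

text \<open>The difference of the two candidates is locally integrable and integrates to zero
  against every product of bumps, so the fundamental lemma applies to a Borel representative of it.
  Properties of one weak derivative thus pass to the chosen one.\<close>

lemma weak_partial_unique:
  fixes u :: "real ^ 'n::finite \<Rightarrow> complex"
  assumes "is_weak_partial i u g" "is_weak_partial i u g'"
  shows "AE x in lborel. g x = g' x"
proof -
  have lg: "locally_integrable g" "locally_integrable g'"
    using assms by (auto simp: is_weak_partial_def)
  note [measurable] = lg[THEN locally_integrable_measurable]
  have "(\<lambda>x. g x - g' x) \<in> borel_measurable lebesgue" by measurable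
  then obtain f where f[measurable]: "f \<in> borel_measurable borel" and ae: "AE x in lborel. g x - g' x = f x"
    by (rule lebesgue_measurable_borel_representative)
  have "AE x in lborel. f x = 0"
  proof (rule AE_zero_if_prod_fun_integrals_zero)
    fix a b :: "real ^ 'n"
    have "set_integrable lebesgue (cbox a b) g" "set_integrable lebesgue (cbox a b) g'"
      using lg by (auto simp: locally_integrable_def)
    then have "set_integrable lebesgue (cbox a b) (\<lambda>x. g x - g' x)"
      by (rule set_integral_diff)
    then have "set_integrable lebesgue (box a b) (\<lambda>x. g x - g' x)"
      by (rule set_integrable_subset) (auto simp: box_subset_cbox)
    then have *: "integrable lebesgue (\<lambda>x. indicator (box a b) x *\<^sub>R (g x - g' x))"
      by (simp add: set_integrable_def)
    moreover have "AE x in lborel. indicator (box a b) x *\<^sub>R (g x - g' x) = indicator (box a b) x *\<^sub>R f x"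
      using ae by eventually_elim simp
    ultimately show "set_integrable lborel (box a b) f"
      unfolding set_integrable_def
      by (subst integrable_lebesgue_iff_lborel[symmetric]) auto
  next
    fix b :: "'n \<Rightarrow> real \<Rightarrow> real"
    assume b: "\<And>j. bump (b j)"
    have [measurable]: "prod_fun b \<in> borel_measurable borel" "prod_fun b \<in> borel_measurable lebesgue"
      using borel_measurable_prod_fun[of b, OF b] by (auto intro: measurable_completion)
    note int = integrable_prod_fun_locally_integrable[of b, OF b lg(1)]
      integrable_prod_fun_locally_integrable[of b, OF b lg(2)]
    have "(LINT x|lborel. prod_fun b x *\<^sub>R f x) = (LINT x|lebesgue. prod_fun b x *\<^sub>R (g x - g' x))"
      using ae by (intro integral_lebesgue_eq_lborel[symmetric]) auto
    also have "\<dots> = (LINT x|lebesgue. prod_fun b x *\<^sub>R g x) - (LINT x|lebesgue. prod_fun b x *\<^sub>R g' x)"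
      using int by (simp add: scaleR_diff_right)
    also have "\<dots> = 0"
    proof -
      have "- (LINT x|lebesgue. prod_fun b x *\<^sub>R g x) = - (LINT x|lebesgue. prod_fun b x *\<^sub>R g' x)"
        using assms test_function_prod_fun[of b, OF b] unfolding is_weak_partial_def by metis
      then show ?thesis by simp
    qed
    finally show "(LINT x|lborel. prod_fun b x *\<^sub>R f x) = 0" .
  qed
  with ae show ?thesis by eventually_elim simp
qed

lemma is_weak_partial_weak_partial:
  "is_weak_partial i u g \<Longrightarrow> is_weak_partial i u (weak_partial i u)"
  unfolding weak_partial_def by (rule someI[where P = "is_weak_partial i u"])

lemma weak_partial_measurable:
  assumes "u \<in> H1_space" shows "weak_partial i u \<in> borel_measurable lebesgue"
proof -
  obtain g where "is_weak_partial i u g"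
    using assms unfolding H1_space_def by blast
  then have "is_weak_partial i u (weak_partial i u)"
    by (rule is_weak_partial_weak_partial)
  then show ?thesis
    by (intro locally_integrable_measurable) (simp add: is_weak_partial_def)
qed

text \<open>Delivers for each element of H^1 exactly the hypotheses of \<open>hardy\<close>,
  together with the almost everywhere equalities that carry the energy over to
  \<open>lborel\<close>.\<close>

lemma H1_borel_representative:
  fixes u :: "real ^ 'n::finite \<Rightarrow> complex"
  assumes "u \<in> H1_space"
  obtains v g where "v \<in> borel_measurable borel" "\<And>i. g i \<in> borel_measurable borel"
    "AE x in lborel. u x = v x" "\<And>i. AE x in lborel. weak_partial i u x = g i x"
    "integrable lborel (\<lambda>x. (cmod (v x))\<^sup>2)" "\<And>i. integrable lborel (\<lambda>x. (cmod (g i x))\<^sup>2)"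
    "\<And>h i. 0 \<le> h \<Longrightarrow>
      AE x in lborel. v (x + h *\<^sub>R axis i 1) - v x = (LINT s:{0..h}|lborel. g i (x + s *\<^sub>R axis i 1))"
proof -
  have um[measurable]: "u \<in> borel_measurable lebesgue" and u2: "integrable lebesgue (\<lambda>x. (cmod (u x))\<^sup>2)"
    using assms by (auto simp: H1_space_def L2_space_def)
  obtain v where v[measurable]: "v \<in> borel_measurable borel" and uv: "AE x in lborel. u x = v x"
    using um by (rule lebesgue_measurable_borel_representative)
  have v2: "integrable lborel (\<lambda>x. (cmod (v x))\<^sup>2)"
  proof (subst integrable_lebesgue_iff_lborel[symmetric])
    show "AE x in lborel. (cmod (u x))\<^sup>2 = (cmod (v x))\<^sup>2" using uv by eventually_elim simp
  qed (use u2 in auto)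
  \<comment> \<open>All requirements on a single component are bundled so that one choice yields the
    whole family \<open>g\<close>.\<close>
  define Q where "Q i g \<longleftrightarrow> g \<in> borel_measurable borel \<and> (AE x in lborel. weak_partial i u x = g x) \<and>
    integrable lborel (\<lambda>x. (cmod (g x))\<^sup>2) \<and>
    (\<forall>h\<ge>0. AE x in lborel. v (x + h *\<^sub>R axis i 1) - v x = (LINT s:{0..h}|lborel. g (x + s *\<^sub>R axis i 1)))"
    for i g
  have "\<exists>g. Q i g" for i
  proof -
    obtain g0 where g0: "g0 \<in> L2_space" "is_weak_partial i u g0"
      using assms unfolding H1_space_def by blast
    define w where "w = weak_partial i u"
    have w: "is_weak_partial i u w"
      unfolding w_def using g0(2) by (rule is_weak_partial_weak_partial)
    \<comment> \<open>The chosen derivative \<open>w\<close> is not square integrable by definition;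
      it inherits this from the witness \<open>g0\<close>.\<close>
    have "AE x in lborel. g0 x = w x"
      using g0(2) w by (rule weak_partial_unique)
    have wm[measurable]: "w \<in> borel_measurable lebesgue"
      unfolding w_def by (rule weak_partial_measurable[OF assms])
    obtain g where g[measurable]: "g \<in> borel_measurable borel" and wg: "AE x in lborel. w x = g x"
      using wm by (rule lebesgue_measurable_borel_representative)
    have g2: "integrable lborel (\<lambda>x. (cmod (g x))\<^sup>2)"
    proof (subst integrable_lebesgue_iff_lborel[symmetric])
      show "AE x in lborel. (cmod (g0 x))\<^sup>2 = (cmod (g x))\<^sup>2"
        using wg \<open>AE x in lborel. g0 x = w x\<close> by eventually_elim simp
    qed (use g0(1) in \<open>auto simp: L2_space_def\<close>)
    have weak: "(LINT x|lborel. prod_fun (b(i := deriv (b i))) x *\<^sub>R v x) = - (LINT x|lborel. prod_fun b x *\<^sub>R g x)"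
      if b: "\<And>j. bump (b j)" for b
    proof -
      define b' where "b' = b(i := deriv (b i))"
      have b': "bump (b' j)" for j
        unfolding b'_def using b by (intro bump_upd bump_deriv) auto
      have [measurable]: "prod_fun b \<in> borel_measurable borel" "prod_fun b \<in> borel_measurable lebesgue"
        "prod_fun b' \<in> borel_measurable borel" "prod_fun b' \<in> borel_measurable lebesgue"
        using borel_measurable_prod_fun[of b, OF b] borel_measurable_prod_fun[of b', OF b']
        by (auto intro: measurable_completion)
      have "(LINT x|lborel. prod_fun b' x *\<^sub>R v x) = (LINT x|lebesgue. prod_fun b' x *\<^sub>R u x)"
        using uv by (intro integral_lebesgue_eq_lborel[symmetric]) auto
      also have "\<dots> = (LINT x|lebesgue. partial_deriv i (prod_fun b) x *\<^sub>R u x)"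
        unfolding b'_def partial_deriv_prod_fun[of b, OF b] ..
      also have "\<dots> = - (LINT x|lebesgue. prod_fun b x *\<^sub>R w x)"
        using w test_function_prod_fun[of b, OF b] unfolding is_weak_partial_def by blast
      also have "(LINT x|lebesgue. prod_fun b x *\<^sub>R w x) = (LINT x|lborel. prod_fun b x *\<^sub>R g x)"
        using wg by (intro integral_lebesgue_eq_lborel) auto
      finally show ?thesis unfolding b'_def .
    qed
    have "AE x in lborel. v (x + h *\<^sub>R axis i 1) - v x = (LINT s:{0..h}|lborel. g (x + s *\<^sub>R axis i 1))"
      if "0 \<le> h" for h
      by (rule weak_partial_difference[OF v g v2 g2 weak that])
    with g wg g2 have "Q i g"
      unfolding Q_def w_def by simp
    then show ?thesis by blast
  qed
  then obtain g where "\<And>i. Q i (g i)" by metis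
  then show ?thesis
    using v uv v2 unfolding Q_def by (intro that[of v g]) simp_all
qed

text \<open>For every \<open>x\<close> the inner integral ignores the null set where
  \<open>u\<close> and \<open>v\<close> differ, so only the outer factor needs an almost everywhere
  argument. Pulling that factor out of the inner integral is valid even under the convention for
  divergent integrals.\<close>

lemma D_energy_lborel:
  fixes u v :: "real ^ 'n::finite \<Rightarrow> complex"
  assumes [measurable]: "u \<in> borel_measurable lebesgue" "v \<in> borel_measurable borel"
    and uv: "AE x in lborel. u x = v x"
  shows "D_energy \<gamma> u = (LINT x|lborel. (cmod (v x))\<^sup>2 * (LINT y|lborel. (cmod (v y))\<^sup>2 / norm (x - y) powr \<gamma>))"
proof -
  have "(LINT y|lebesgue. (cmod (u x))\<^sup>2 * (cmod (u y))\<^sup>2 / norm (x - y) powr \<gamma>)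
     = (cmod (u x))\<^sup>2 * (LINT y|lborel. (cmod (v y))\<^sup>2 / norm (x - y) powr \<gamma>)" for x
  proof -
    have "(\<lambda>y. norm (x - y) powr \<gamma>) \<in> borel_measurable borel" by measurable
    then have [measurable]: "(\<lambda>y. norm (x - y) powr \<gamma>) \<in> borel_measurable lebesgue"
      by (auto intro: measurable_completion)
    have "(LINT y|lebesgue. (cmod (u x))\<^sup>2 * (cmod (u y))\<^sup>2 / norm (x - y) powr \<gamma>)
      = (cmod (u x))\<^sup>2 * (LINT y|lebesgue. (cmod (u y))\<^sup>2 / norm (x - y) powr \<gamma>)"
      by (subst integral_mult_right_zero[symmetric]) simp
    also have "(LINT y|lebesgue. (cmod (u y))\<^sup>2 / norm (x - y) powr \<gamma>)
       = (LINT y|lborel. (cmod (v y))\<^sup>2 / norm (x - y) powr \<gamma>)"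
    proof (rule integral_lebesgue_eq_lborel)
      show "AE y in lborel. (cmod (u y))\<^sup>2 / norm (x - y) powr \<gamma> = (cmod (v y))\<^sup>2 / norm (x - y) powr \<gamma>"
        using uv by eventually_elim simp
    qed measurable
    finally show ?thesis .
  qed
  then have "D_energy \<gamma> u = (LINT x|lebesgue. (cmod (u x))\<^sup>2 * (LINT y|lborel. (cmod (v y))\<^sup>2 / norm (x - y) powr \<gamma>))"
    unfolding D_energy_def by simp
  also have "\<dots> = (LINT x|lborel. (cmod (v x))\<^sup>2 * (LINT y|lborel. (cmod (v y))\<^sup>2 / norm (x - y) powr \<gamma>))"
  proof (rule integral_lebesgue_eq_lborel)
    have [measurable]: "(\<lambda>x. LINT y|lborel. (cmod (v y))\<^sup>2 / norm (x - y) powr \<gamma>) \<in> borel_measurable borel"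
      by measurable
    then have [measurable]: "(\<lambda>x. LINT y|lborel. (cmod (v y))\<^sup>2 / norm (x - y) powr \<gamma>) \<in> borel_measurable lebesgue"
      by (auto intro: measurable_completion)
    show "(\<lambda>x. (cmod (u x))\<^sup>2 * (LINT y|lborel. (cmod (v y))\<^sup>2 / norm (x - y) powr \<gamma>)) \<in> borel_measurable lebesgue"
      by measurable
    show "AE x in lborel. (cmod (u x))\<^sup>2 * (LINT y|lborel. (cmod (v y))\<^sup>2 / norm (x - y) powr \<gamma>)
      = (cmod (v x))\<^sup>2 * (LINT y|lborel. (cmod (v y))\<^sup>2 / norm (x - y) powr \<gamma>)"
      using uv by eventually_elim simp
  qed measurable
  finally show ?thesis .
qed

section \<open>Kernel bounds and the lower bound on the energy\<close>

text \<open>Beyond distance 1 the kernel is at most 1, and closer it lies below the Hardy weight; at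
  \<open>r = 0\<close> both quotients are 0. The bound serves to make each nonlocal term
  finite.\<close>

lemma inverse_powr_le:
  fixes r :: real assumes "0 \<le> r" "0 < \<gamma>" "\<gamma> < 2"
  shows "1 / r powr \<gamma> \<le> 1 + 1 / r\<^sup>2"
proof (cases "r = 0 \<or> r \<ge> 1")
  case True
  then have "1 / r powr \<gamma> \<le> 1"
    using assms(2) ge_one_powr_ge_zero[of r \<gamma>] by auto
  then show ?thesis by (smt (verit) zero_le_power2 divide_nonneg_nonneg)
next
  case False
  then have r: "0 < r" "r < 1" using assms(1) by auto
  have "r powr 2 \<le> r powr \<gamma>"
    using r assms(3) by (intro powr_mono') auto
  then have "1 / r powr \<gamma> \<le> 1 / r powr 2"
    using r by (intro divide_left_mono) auto
  then show ?thesis using r by (simp add: powr_numeral)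
qed

text \<open>For \<open>r >= 1\<close> the left-hand side is at most 0, because the repulsive kernel
  has the smaller exponent; for \<open>r < 1\<close> it is dropped and
  \<open>\<gamma>\<^sub>1 < 2\<close> suffices. In contrast to \<open>inverse_powr_le\<close> there
  is no additive constant, which would leave a multiple of c^2 that the gradient does not
  control.\<close>

lemma inverse_powr_diff_le:
  fixes r :: real assumes "0 \<le> r" "\<gamma>\<^sub>2 < \<gamma>\<^sub>1" "\<gamma>\<^sub>1 < 2"
  shows "1 / r powr \<gamma>\<^sub>1 - 1 / r powr \<gamma>\<^sub>2 \<le> 1 / r\<^sup>2"
proof (cases "r \<ge> 1")
  case True
  then have "1 / r powr \<gamma>\<^sub>1 \<le> 1 / r powr \<gamma>\<^sub>2"
    using assms by (intro divide_left_mono powr_mono) auto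
  then show ?thesis by (smt (verit) zero_le_power2 divide_nonneg_nonneg)
next
  case False
  show ?thesis
  proof (cases "r = 0")
    case False
    then have r: "0 < r" "r < 1" using assms(1) \<open>\<not> r \<ge> 1\<close> by auto
    have "r powr 2 \<le> r powr \<gamma>\<^sub>1"
      using r assms(3) by (intro powr_mono') auto
    then have "1 / r powr \<gamma>\<^sub>1 \<le> 1 / r powr 2"
      using r by (intro divide_left_mono) auto
    then have "1 / r powr \<gamma>\<^sub>1 \<le> 1 / r\<^sup>2"
      using r by (simp add: powr_numeral)
    moreover have "0 \<le> 1 / r powr \<gamma>\<^sub>2" by simp
    ultimately show ?thesis by linarith
  qed simp
qed

lemma integral_grad_norm_sq:
  fixes u :: "real ^ 'n::finite \<Rightarrow> complex"
  assumes [measurable]: "\<And>i. weak_partial i u \<in> borel_measurable lebesgue" "\<And>i. g i \<in> borel_measurable borel"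
    and ae: "\<And>i. AE x in lborel. weak_partial i u x = g i x"
    and int: "\<And>i. integrable lborel (\<lambda>x. (cmod (g i x))\<^sup>2)"
  shows "(LINT x|lebesgue. grad_norm_sq u x) = (\<Sum>i\<in>UNIV. LINT x|lborel. (cmod (g i x))\<^sup>2)"
proof -
  have "(LINT x|lebesgue. grad_norm_sq u x) = (LINT x|lborel. (\<Sum>i\<in>UNIV. (cmod (g i x))\<^sup>2))"
    unfolding grad_norm_sq_def
  proof (rule integral_lebesgue_eq_lborel)
    have "AE x in lborel. \<forall>i\<in>UNIV. weak_partial i u x = g i x"
      using ae by (intro AE_finite_allI) auto
    then show "AE x in lborel. (\<Sum>i\<in>UNIV. (cmod (weak_partial i u x))\<^sup>2) = (\<Sum>i\<in>UNIV. (cmod (g i x))\<^sup>2)"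
      by eventually_elim simp
  qed measurable
  also have "\<dots> = (\<Sum>i\<in>UNIV. LINT x|lborel. (cmod (g i x))\<^sup>2)"
    using int by (intro Bochner_Integration.integral_sum) auto
  finally show ?thesis .
qed

text \<open>Hardy's inequality is applied to one of the two densities, uniformly in the other
  variable; the remaining density then contributes only its mass \<open>c\<close>.\<close>

lemma energy_pos:
  fixes u :: "real ^ 'n::finite \<Rightarrow> complex"
  assumes N: "CARD('n) \<ge> 3" and \<gamma>: "0 < \<gamma>\<^sub>2" "\<gamma>\<^sub>2 < \<gamma>\<^sub>1" "\<gamma>\<^sub>1 < 2"
    and u: "u \<in> mass_sphere c" and c: "0 < c" "c < 1 / 2"
  shows "0 < energy \<gamma>\<^sub>1 \<gamma>\<^sub>2 u"
proof -
  have uH: "u \<in> H1_space" and uc: "(LINT x|lebesgue. (cmod (u x))\<^sup>2) = c"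
    using u by (auto simp: mass_sphere_def)
  have um[measurable]: "u \<in> borel_measurable lebesgue"
    using uH by (auto simp: H1_space_def L2_space_def)
  show ?thesis
  proof (rule H1_borel_representative[OF uH])
    fix v and g :: "'n \<Rightarrow> real ^ 'n \<Rightarrow> complex"
    assume v[measurable]: "v \<in> borel_measurable borel" and g[measurable]: "\<And>i. g i \<in> borel_measurable borel"
      and uv: "AE x in lborel. u x = v x" and wg: "\<And>i. AE x in lborel. weak_partial i u x = g i x"
      and v2: "integrable lborel (\<lambda>x. (cmod (v x))\<^sup>2)" and g2: "\<And>i. integrable lborel (\<lambda>x. (cmod (g i x))\<^sup>2)"
      and diff: "\<And>h i. 0 \<le> h \<Longrightarrow>
        AE x in lborel. v (x + h *\<^sub>R axis i 1) - v x = (LINT s:{0..h}|lborel. g i (x + s *\<^sub>R axis i 1))"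
    define G where "G = (\<Sum>i\<in>UNIV. LINT x|lborel. (cmod (g i x))\<^sup>2)"
    have G0: "0 \<le> G" unfolding G_def by (intro sum_nonneg integral_nonneg_AE) auto
    have vc: "(LINT x|lborel. (cmod (v x))\<^sup>2) = c"
      unfolding uc[symmetric] using uv by (intro integral_lebesgue_eq_lborel[symmetric]) auto
    have hardy': "(\<integral>\<^sup>+y. (cmod (v y))\<^sup>2 / (norm (x - y))\<^sup>2 \<partial>lborel) \<le> ennreal (4 * G)" for x
      using hardy[OF N v g v2 g2 diff, of x] unfolding G_def by (simp add: norm_minus_commute)
    define H where "H x = (LINT y|lborel. (cmod (v y))\<^sup>2 / (norm (x - y))\<^sup>2)" for x
    have H_int: "integrable lborel (\<lambda>y. (cmod (v y))\<^sup>2 / (norm (x - y))\<^sup>2)" for x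
      using le_less_trans[OF hardy'[of x] ennreal_less_top] by (intro integrableI_bounded) auto
    have H_le: "H x \<le> 4 * G" for x
      unfolding H_def using hardy'[of x] G0 by (intro integral_real_bounded) auto
    \<comment> \<open>The potential generated by |v|^2. Its bounds hold at every \<open>x\<close>,
      not just almost everywhere.\<close>
    define P where "P \<gamma> x = (LINT y|lborel. (cmod (v y))\<^sup>2 / norm (x - y) powr \<gamma>)" for \<gamma> x
    have [measurable]: "P \<gamma> \<in> borel_measurable borel" for \<gamma>
      unfolding P_def[abs_def] by measurable
    have P_bound: "(cmod (v y))\<^sup>2 / norm (x - y) powr \<gamma> \<le> (cmod (v y))\<^sup>2 + (cmod (v y))\<^sup>2 / (norm (x - y))\<^sup>2"
      if "0 < \<gamma>" "\<gamma> < 2" for \<gamma> x y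
      using mult_left_mono[OF inverse_powr_le[OF norm_ge_zero[of "x - y"] that], of "(cmod (v y))\<^sup>2"]
      by (simp add: distrib_left)
    have P_int: "integrable lborel (\<lambda>y. (cmod (v y))\<^sup>2 / norm (x - y) powr \<gamma>)" if "0 < \<gamma>" "\<gamma> < 2" for \<gamma> x
    proof (rule Bochner_Integration.integrable_bound[OF Bochner_Integration.integrable_add[OF v2 H_int[of x]]])
      show "AE y in lborel. norm ((cmod (v y))\<^sup>2 / norm (x - y) powr \<gamma>)
        \<le> norm ((cmod (v y))\<^sup>2 + (cmod (v y))\<^sup>2 / (norm (x - y))\<^sup>2)"
        using P_bound[OF that, of _ x] by (intro AE_I2) simp
    qed measurable
    have P_le: "0 \<le> P \<gamma> x" "P \<gamma> x \<le> c + 4 * G" if "0 < \<gamma>" "\<gamma> < 2" for \<gamma> x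
    proof -
      show "0 \<le> P \<gamma> x" unfolding P_def by (intro integral_nonneg_AE) auto
      have "P \<gamma> x \<le> (LINT y|lborel. (cmod (v y))\<^sup>2 + (cmod (v y))\<^sup>2 / (norm (x - y))\<^sup>2)"
        unfolding P_def using P_bound[OF that, of _ x] P_int[OF that, of x] v2 H_int[of x]
        by (intro integral_mono) auto
      also have "\<dots> = c + H x" using v2 H_int[of x] vc by (simp add: H_def)
      also have "\<dots> \<le> c + 4 * G" using H_le[of x] by simp
      finally show "P \<gamma> x \<le> c + 4 * G" .
    qed
    have P_diff: "P \<gamma>\<^sub>1 x - P \<gamma>\<^sub>2 x \<le> 4 * G" for x
    proof -
      have "P \<gamma>\<^sub>1 x - P \<gamma>\<^sub>2 x = (LINT y|lborel. (cmod (v y))\<^sup>2 / norm (x - y) powr \<gamma>\<^sub>1 - (cmod (v y))\<^sup>2 / norm (x - y) powr \<gamma>\<^sub>2)"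
        unfolding P_def using P_int[of \<gamma>\<^sub>1 x] P_int[of \<gamma>\<^sub>2 x] \<gamma> by simp
      also have "\<dots> \<le> H x"
        unfolding H_def
      proof (rule integral_mono)
        fix y
        show "(cmod (v y))\<^sup>2 / norm (x - y) powr \<gamma>\<^sub>1 - (cmod (v y))\<^sup>2 / norm (x - y) powr \<gamma>\<^sub>2
          \<le> (cmod (v y))\<^sup>2 / (norm (x - y))\<^sup>2"
          using mult_left_mono[OF inverse_powr_diff_le[OF norm_ge_zero[of "x - y"] \<gamma>(2,3)], of "(cmod (v y))\<^sup>2"]
          by (simp add: right_diff_distrib)
      qed (use P_int[of \<gamma>\<^sub>1 x] P_int[of \<gamma>\<^sub>2 x] \<gamma> H_int in auto)
      finally show ?thesis using H_le[of x] by simp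
    qed
    \<comment> \<open>Integrability of each nonlocal term by itself is what allows the difference of
      the two integrals to be written as one integral and compared pointwise.\<close>
    have vP_int: "integrable lborel (\<lambda>x. (cmod (v x))\<^sup>2 * P \<gamma> x)" if "0 < \<gamma>" "\<gamma> < 2" for \<gamma>
    proof (rule Bochner_Integration.integrable_bound[OF integrable_mult_left[OF v2, of "c + 4 * G"]])
      show "AE x in lborel. norm ((cmod (v x))\<^sup>2 * P \<gamma> x) \<le> norm ((cmod (v x))\<^sup>2 * (c + 4 * G))"
      proof (rule AE_I2)
        fix x
        show "norm ((cmod (v x))\<^sup>2 * P \<gamma> x) \<le> norm ((cmod (v x))\<^sup>2 * (c + 4 * G))"
          using P_le[OF that, of x] unfolding norm_mult by (intro mult_left_mono) auto
      qed
    qed measurable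
    have "D_energy \<gamma>\<^sub>1 u - D_energy \<gamma>\<^sub>2 u = (LINT x|lborel. (cmod (v x))\<^sup>2 * P \<gamma>\<^sub>1 x - (cmod (v x))\<^sup>2 * P \<gamma>\<^sub>2 x)"
      unfolding D_energy_lborel[OF um v uv] P_def[symmetric] using vP_int \<gamma> by simp
    also have "\<dots> \<le> (LINT x|lborel. (cmod (v x))\<^sup>2 * (4 * G))"
    proof (rule integral_mono)
      fix x
      show "(cmod (v x))\<^sup>2 * P \<gamma>\<^sub>1 x - (cmod (v x))\<^sup>2 * P \<gamma>\<^sub>2 x \<le> (cmod (v x))\<^sup>2 * (4 * G)"
        unfolding right_diff_distrib[symmetric] by (intro mult_left_mono P_diff) auto
    qed (use vP_int \<gamma> v2 in auto)
    also have "\<dots> = c * (4 * G)"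
      by (simp add: vc)
    finally have "D_energy \<gamma>\<^sub>1 u - D_energy \<gamma>\<^sub>2 u \<le> c * (4 * G)" .
    moreover have "(LINT x|lebesgue. grad_norm_sq u x) = G"
      unfolding G_def by (rule integral_grad_norm_sq[OF weak_partial_measurable[OF uH] g wg g2])
    \<comment> \<open>The coefficient is 1/2 - (1/4) * 4 c.\<close>
    ultimately have E: "G * (1 / 2 - c) \<le> energy \<gamma>\<^sub>1 \<gamma>\<^sub>2 u"
      unfolding energy_def by (simp add: algebra_simps)
    \<comment> \<open>Hardy's inequality also gives strictness: a vanishing gradient would force
      \<open>v = 0\<close> almost everywhere, contradicting \<open>c > 0\<close>.\<close>
    have "G \<noteq> 0"
    proof
      assume "G = 0"
      then have "(\<integral>\<^sup>+y. (cmod (v y))\<^sup>2 / (norm (0 - y))\<^sup>2 \<partial>lborel) = 0"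
        using hardy'[of 0] by simp
      then have "AE y in lborel. ennreal ((cmod (v y))\<^sup>2 / (norm (0 - y))\<^sup>2) = 0"
        by (subst (asm) nn_integral_0_iff_AE) auto
      moreover have "AE y in lborel. y \<noteq> (0 :: real ^ 'n)"
        by (rule AE_lborel_singleton)
      ultimately have "AE y in lborel. (cmod (v y))\<^sup>2 = 0"
        by eventually_elim (simp add: ennreal_eq_0_iff divide_le_0_iff)
      then have "(LINT y|lborel. (cmod (v y))\<^sup>2) = 0"
        by (rule integral_eq_zero_AE)
      then show False using vc c by simp
    qed
    with G0 c have "0 < G * (1 / 2 - c)" by simp
    with E show ?thesis by linarith
  qed
qed

section \<open>Test functions of small energy\<close>

lemma integrable_continuous_bounded_support:
  fixes f :: "'a::euclidean_space \<Rightarrow> 'b::euclidean_space"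
  assumes "continuous_on UNIV f" "\<And>x. x \<notin> cbox a b \<Longrightarrow> f x = 0"
  shows "integrable lborel f"
proof -
  have "integrable lborel (\<lambda>x. indicator (cbox a b) x *\<^sub>R f x)"
    by (intro borel_integrable_compact compact_cbox continuous_on_subset[OF assms(1)]) auto
  moreover have "(\<lambda>x. indicator (cbox a b) x *\<^sub>R f x) = f"
    using assms(2) by (auto simp: indicator_def fun_eq_iff)
  ultimately show ?thesis by simp
qed

text \<open>Difference quotients of an integrable function have integral zero by translation
  invariance; the mean value theorem gives a bound uniform in the step, and dominated convergence
  passes to the derivative. This is the integration by parts behind
  \<open>is_weak_partial_prod_fun\<close>.\<close>

lemma integral_line_derivative_eq_0:
  fixes f D :: "'a::euclidean_space \<Rightarrow> real"
  assumes D: "\<And>x. ((\<lambda>s. f (x + s *\<^sub>R e)) has_real_derivative D x) (at 0)"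
    and cont: "continuous_on UNIV f" "continuous_on UNIV D"
    and f0: "\<And>x. x \<notin> cbox a b \<Longrightarrow> f x = 0" and D0: "\<And>x. x \<notin> cbox a b \<Longrightarrow> D x = 0"
  shows "(LINT x|lborel. D x) = 0"
proof -
  define h where "h n = inverse (real (Suc n))" for n
  have h: "0 < h n" "h n \<le> 1" "h \<longlonglongrightarrow> 0" for n
    unfolding h_def using LIMSEQ_inverse_real_of_nat by (auto simp: inverse_le_1_iff)
  have [measurable]: "f \<in> borel_measurable borel" "D \<in> borel_measurable borel"
    using cont by (auto intro: borel_measurable_continuous_onI)
  have f_int: "integrable lborel f"
    using cont(1) f0 by (rule integrable_continuous_bounded_support)
  define q where "q n x = (f (x + h n *\<^sub>R e) - f x) / h n" for n x
  have line: "((\<lambda>s. f (x + s *\<^sub>R e)) has_real_derivative D (x + t *\<^sub>R e)) (at t)" for x t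
    using D[of "x + t *\<^sub>R e"] DERIV_shift[of "\<lambda>s. f (x + s *\<^sub>R e)" "D (x + t *\<^sub>R e)" 0 t]
    by (simp add: algebra_simps scaleR_add_left)
  have mvt: "\<exists>z. 0 < z \<and> z < h n \<and> q n x = D (x + z *\<^sub>R e)" for n x
  proof -
    obtain z where "0 < z" "z < h n" "f (x + h n *\<^sub>R e) - f (x + 0 *\<^sub>R e) = (h n - 0) * D (x + z *\<^sub>R e)"
      using MVT2[OF h(1)[of n], of "\<lambda>s. f (x + s *\<^sub>R e)" "\<lambda>s. D (x + s *\<^sub>R e)"] line by blast
    then show ?thesis using h(1)[of n] by (intro exI[of _ z]) (simp add: q_def)
  qed
  have "compact (D ` cbox a b)"
    by (intro compact_continuous_image compact_cbox continuous_on_subset[OF cont(2)]) auto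
  then obtain M where M: "\<And>x. x \<in> cbox a b \<Longrightarrow> \<bar>D x\<bar> \<le> M"
    by (meson compact_imp_bounded bounded_real imageI)
  obtain r where r: "\<And>x. x \<in> cbox a b \<Longrightarrow> norm x \<le> r"
    using bounded_cbox[of a b] bounded_iff by metis
  \<comment> \<open>The mean value point is displaced from \<open>x\<close> by at most |e|, since
    \<open>h n <= 1\<close>; enlarging the ball by that amount covers all quotients at once.\<close>
  define K :: "'a set" where "K = cball 0 (r + norm e)"
  have bound: "\<bar>q n x\<bar> \<le> \<bar>M\<bar> * indicator K x" for n x
  proof -
    obtain z where z: "0 < z" "z < h n" "q n x = D (x + z *\<^sub>R e)" using mvt[of n x] by blast
    show ?thesis
    proof (cases "x + z *\<^sub>R e \<in> cbox a b")
      case True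
      have "norm x \<le> norm (x + z *\<^sub>R e) + norm (z *\<^sub>R e)"
        using norm_triangle_ineq4[of "x + z *\<^sub>R e" "z *\<^sub>R e"] by simp
      also have "\<dots> \<le> r + norm e"
        using r[OF True] z(1,2) h(2)[of n] mult_right_mono[of z 1 "norm e"] by (simp add: add_mono)
      finally have "x \<in> K" by (simp add: K_def)
      then show ?thesis using M[OF True] z(3) by simp
    next
      case False
      then show ?thesis using D0 z(3) by simp
    qed
  qed
  have "(\<lambda>n. LINT x|lborel. q n x) \<longlonglongrightarrow> (LINT x|lborel. D x)"
  proof (rule integral_dominated_convergence)
    show "integrable lborel (\<lambda>x. \<bar>M\<bar> * indicator K x)"
      unfolding K_def using emeasure_bounded_finite[OF bounded_cball]
      by (intro integrable_mult_right integrable_real_indicator) (auto simp: less_top)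
    show "AE x in lborel. norm (q n x) \<le> \<bar>M\<bar> * indicator K x" for n
      using bound by simp
    show "AE x in lborel. (\<lambda>n. q n x) \<longlonglongrightarrow> D x"
    proof (rule AE_I2)
      fix x
      have "((\<lambda>k. (f (x + (0 + k) *\<^sub>R e) - f (x + 0 *\<^sub>R e)) / k) \<longlongrightarrow> D x) (at 0)"
        using D[of x] unfolding DERIV_def by simp
      moreover have "filterlim h (at 0) sequentially"
        unfolding filterlim_at using h by (auto simp: less_imp_neq[symmetric])
      ultimately have "(\<lambda>n. (f (x + (0 + h n) *\<^sub>R e) - f (x + 0 *\<^sub>R e)) / h n) \<longlonglongrightarrow> D x"
        by (rule filterlim_compose)
      then show "(\<lambda>n. q n x) \<longlonglongrightarrow> D x" by (simp add: q_def)
    qed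
    show "q n \<in> borel_measurable lborel" for n unfolding q_def[abs_def] by measurable
  qed measurable
  moreover have "(LINT x|lborel. q n x) = 0" for n
  proof -
    have "integrable lborel (\<lambda>x. f (x + h n *\<^sub>R e))"
      using f_int by (simp add: integrable_lborel_translation)
    then show ?thesis
      unfolding q_def using f_int integral_lborel_translation[of f "h n *\<^sub>R e"] by simp
  qed
  ultimately show ?thesis by (simp add: LIMSEQ_const_iff)
qed

lemma has_derivative_line:
  assumes "(f has_derivative f') (at x)"
  shows "((\<lambda>s::real. f (x + s *\<^sub>R e)) has_derivative (\<lambda>s. f' (s *\<^sub>R e))) (at 0)"
proof -
  have "((\<lambda>s::real. x + s *\<^sub>R e) has_derivative (\<lambda>s. s *\<^sub>R e)) (at 0)"
    by (auto intro!: derivative_eq_intros)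
  moreover have "(f has_derivative f') (at (x + 0 *\<^sub>R e))"
    using assms by simp
  ultimately show ?thesis
    using has_derivative_compose[of "\<lambda>s. x + s *\<^sub>R e" "\<lambda>s. s *\<^sub>R e" 0 UNIV f f'] by simp
qed

lemma partial_deriv_line:
  fixes f :: "real ^ 'n::finite \<Rightarrow> real"
  assumes "f differentiable at x"
  shows "((\<lambda>s. f (x + s *\<^sub>R axis i 1)) has_real_derivative partial_deriv i f x) (at 0)"
proof -
  let ?d = "frechet_derivative f (at x)"
  have d: "(f has_derivative ?d) (at x)"
    using assms by (simp add: frechet_derivative_works)
  have "?d (s *\<^sub>R axis i 1) = partial_deriv i f x * s" for s
    using linear_scale[OF has_derivative_linear[OF d]] by (simp add: partial_deriv_def)
  then show ?thesis
    using has_derivative_line[OF d, of "axis i 1"] by (simp add: has_field_derivative_def)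
qed

lemma continuous_locally_integrable:
  fixes f :: "real ^ 'n::finite \<Rightarrow> complex"
  assumes "continuous_on UNIV f" shows "locally_integrable f"
  unfolding locally_integrable_def
proof (intro allI impI)
  fix K :: "(real ^ 'n) set" assume K: "compact K"
  have "integrable lborel (\<lambda>x. indicator K x *\<^sub>R f x)"
    by (intro borel_integrable_compact K continuous_on_subset[OF assms]) auto
  then show "set_integrable lebesgue K f"
    unfolding set_integrable_def
    by (subst integrable_completion) (auto intro: borel_measurable_integrable)
qed

text \<open>The product of \<phi> with \<open>prod_fun b\<close> has a classical derivative along
  the axis, whose integral is zero; the product rule splits it into the two sides of the weak
  identity.\<close>

lemma is_weak_partial_prod_fun:
  fixes b :: "'n::finite \<Rightarrow> real \<Rightarrow> real"
  assumes b: "\<And>j. bump (b j)"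
  shows "is_weak_partial i (\<lambda>x. complex_of_real (k * prod_fun b x))
    (\<lambda>x. complex_of_real (k * prod_fun (b(i := deriv (b i))) x))"
proof -
  define b' where "b' = b(i := deriv (b i))"
  have b': "bump (b' j)" for j
    unfolding b'_def using b by (intro bump_upd bump_deriv) auto
  note c = continuous_on_prod_fun[of b, OF b] continuous_on_prod_fun[of b', OF b']
  have "(LINT x|lebesgue. partial_deriv i \<phi> x *\<^sub>R complex_of_real (k * prod_fun b x))
    = - (LINT x|lebesgue. \<phi> x *\<^sub>R complex_of_real (k * prod_fun b' x))" if \<phi>: "test_function \<phi>" for \<phi>
  proof -
    have \<phi>d: "\<phi> differentiable at x" for x
      using \<phi> unfolding test_function_def by (metis C_diff.simps(2))
    have \<phi>c: "continuous_on UNIV \<phi>" "continuous_on UNIV (partial_deriv i \<phi>)"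
      using \<phi> unfolding test_function_def by (metis C_diff.simps)+
    obtain R where R: "R > 0" "\<And>x. x \<notin> cbox (\<chi> i. - R) (\<chi> i. R) \<Longrightarrow> prod_fun b x = 0"
      using prod_fun_support[of b, OF b] by blast
    obtain R' where R': "R' > 0" "\<And>x. x \<notin> cbox (\<chi> i. - R') (\<chi> i. R') \<Longrightarrow> prod_fun b' x = 0"
      using prod_fun_support[of b', OF b'] by blast
    \<comment> \<open>The supports of the two product functions confine both integrands, so one box
      works for every \<phi>.\<close>
    define C :: "(real ^ 'n) set" where "C = cbox (\<chi> i. - max R R') (\<chi> i. max R R')"
    have C0: "prod_fun b x = 0" "prod_fun b' x = 0" if "x \<notin> C" for x
    proof -
      have "cbox (\<chi> i. - R) (\<chi> i. R) \<subseteq> C" "cbox (\<chi> i. - R') (\<chi> i. R') \<subseteq> C"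
        unfolding C_def by (rule subset_interval_imp_cart(1); simp)+
      with that have "x \<notin> cbox (\<chi> i. - R) (\<chi> i. R)" "x \<notin> cbox (\<chi> i. - R') (\<chi> i. R')"
        by blast+
      then show "prod_fun b x = 0" "prod_fun b' x = 0" using R R' by auto
    qed
    have int: "integrable lborel (\<lambda>x. partial_deriv i \<phi> x * prod_fun b x)"
      "integrable lborel (\<lambda>x. \<phi> x * prod_fun b' x)"
      using C0 unfolding C_def
      by (auto intro!: integrable_continuous_bounded_support[where a = "\<chi> i. - max R R'" and b = "\<chi> i. max R R'"]
          continuous_intros \<phi>c c)
    have "(LINT x|lborel. partial_deriv i \<phi> x * prod_fun b x + \<phi> x * prod_fun b' x) = 0"
    proof (rule integral_line_derivative_eq_0[where f = "\<lambda>x. \<phi> x * prod_fun b x"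
          and e = "axis i 1" and a = "\<chi> i. - max R R'" and b = "\<chi> i. max R R'"])
      fix x
      have "((\<lambda>s. prod_fun b (x + s *\<^sub>R axis i 1)) has_real_derivative prod_fun b' x) (at 0)"
        using partial_deriv_line[of "prod_fun b" x i] differentiableI[OF prod_fun_has_derivative[of b, OF b]]
        unfolding partial_deriv_prod_fun[of b, OF b] b'_def by blast
      from DERIV_mult[OF partial_deriv_line[OF \<phi>d, of x i] this]
      show "((\<lambda>s. \<phi> (x + s *\<^sub>R axis i 1) * prod_fun b (x + s *\<^sub>R axis i 1)) has_real_derivative
         partial_deriv i \<phi> x * prod_fun b x + \<phi> x * prod_fun b' x) (at 0)"
        by (simp add: mult.commute)
    qed (use C0 in \<open>auto intro!: continuous_intros \<phi>c c simp: C_def\<close>)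
    then have eq: "(LINT x|lborel. partial_deriv i \<phi> x * prod_fun b x) = - (LINT x|lborel. \<phi> x * prod_fun b' x)"
      using int by simp
    have L: "(LINT x|lebesgue. f x *\<^sub>R complex_of_real (k * p x)) = complex_of_real (k * (LINT x|lborel. f x * p x))"
      if "continuous_on UNIV f" "continuous_on UNIV p" for f p :: "real ^ 'n \<Rightarrow> real"
    proof -
      have [measurable]: "f \<in> borel_measurable borel" "p \<in> borel_measurable borel"
        using that by (auto intro: borel_measurable_continuous_onI)
      have "(LINT x|lebesgue. f x *\<^sub>R complex_of_real (k * p x)) = (LINT x|lborel. complex_of_real (k * (f x * p x)))"
        by (subst integral_completion) (auto simp: scaleR_conv_of_real ac_simps)
      also have "\<dots> = complex_of_real (LINT x|lborel. k * (f x * p x))"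
        by (rule integral_complex_of_real)
      finally show ?thesis by simp
    qed
    show ?thesis
      by (simp only: L[OF \<phi>c(2) c(1)] L[OF \<phi>c(1) c(2)] eq) simp
  qed
  then show ?thesis
    unfolding is_weak_partial_def b'_def[symmetric]
    by (auto intro!: continuous_locally_integrable continuous_intros c)
qed

lemma prod_fun_H1:
  fixes b :: "'n::finite \<Rightarrow> real \<Rightarrow> real"
  assumes b: "\<And>j. bump (b j)"
  shows "(\<lambda>x. complex_of_real (k * prod_fun b x)) \<in> H1_space"
proof -
  have L2: "(\<lambda>x. complex_of_real (k * prod_fun b x)) \<in> L2_space" if b: "\<And>j. bump (b j)" for b :: "'n \<Rightarrow> real \<Rightarrow> real"
  proof -
    have [measurable]: "prod_fun b \<in> borel_measurable borel" "prod_fun b \<in> borel_measurable lebesgue"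
      using borel_measurable_prod_fun[of b, OF b] by (auto intro: measurable_completion)
    have "integrable lborel (\<lambda>x. k\<^sup>2 * (prod_fun b x)\<^sup>2)"
      using integrable_square_prod_fun[of b, OF b] by simp
    then have "integrable lebesgue (\<lambda>x. (cmod (complex_of_real (k * prod_fun b x)))\<^sup>2)"
      by (subst integrable_completion) (auto simp: power_mult_distrib norm_mult)
    then show ?thesis by (simp add: L2_space_def)
  qed
  have "\<exists>g\<in>L2_space. is_weak_partial i (\<lambda>x. complex_of_real (k * prod_fun b x)) g" for i
  proof
    show "is_weak_partial i (\<lambda>x. complex_of_real (k * prod_fun b x))
      (\<lambda>x. complex_of_real (k * prod_fun (b(i := deriv (b i))) x))"
      using b by (rule is_weak_partial_prod_fun)
    show "(\<lambda>x. complex_of_real (k * prod_fun (b(i := deriv (b i))) x)) \<in> L2_space"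
      using b by (intro L2 bump_upd bump_deriv) auto
  qed
  then show ?thesis
    using L2[of b, OF b] by (simp add: H1_space_def)
qed

section \<open>Dilations\<close>

lemma integral_lborel_scale:
  fixes f :: "real ^ 'n::finite \<Rightarrow> 'b::{banach, second_countable_topology}"
  assumes [measurable]: "f \<in> borel_measurable borel" and t: "0 < t"
  shows "(LINT x|lborel. f (t *\<^sub>R x)) = (1 / t ^ CARD('n)) *\<^sub>R (LINT x|lborel. f x)"
proof -
  have "(LINT x|lborel. f x) = (LINT x|density (distr lborel borel (\<lambda>x. 0 + t *\<^sub>R x)) (\<lambda>_. ennreal (\<bar>t\<bar> ^ DIM(real ^ 'n))). f x)"
    using lborel_affine[of t "0 :: real ^ 'n"] t by simp
  also have "\<dots> = t ^ CARD('n) *\<^sub>R (LINT x|lborel. f (t *\<^sub>R x))"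
    using t by (simp add: integral_density integral_distr)
  finally show ?thesis using t by simp
qed

text \<open>The amplitude \<open>k\<close> is kept independent of \<open>t\<close> so that the mass
  factor \<kappa> can be held fixed while \<open>t\<close> tends to 0. Every energy term then
  carries a positive power of \<open>t\<close> when the exponents are positive: a derivative costs
  \<open>t\<close>, and the kernel of order \<gamma> costs \<open>t powr \<gamma>\<close>.\<close>

lemma energy_scaling:
  fixes b :: "'n::finite \<Rightarrow> real \<Rightarrow> real" and k t :: real
  assumes b: "\<And>j. bump (b j)" and t: "0 < t"
  defines "u \<equiv> \<lambda>x. complex_of_real (k * prod_fun (\<lambda>j s. b j (t * s)) x)"
    and "\<kappa> \<equiv> k\<^sup>2 / t ^ CARD('n)"
  shows "u \<in> mass_sphere (\<kappa> * (LINT x|lborel. (prod_fun b x)\<^sup>2))"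
    and "energy \<gamma>\<^sub>1 \<gamma>\<^sub>2 u = 1 / 2 * (\<kappa> * t\<^sup>2 * (\<Sum>i\<in>UNIV. LINT x|lborel. (prod_fun (b(i := deriv (b i))) x)\<^sup>2))
      + 1 / 4 * (\<kappa>\<^sup>2 * t powr \<gamma>\<^sub>2 * D_energy \<gamma>\<^sub>2 (\<lambda>x. complex_of_real (prod_fun b x)))
      - 1 / 4 * (\<kappa>\<^sup>2 * t powr \<gamma>\<^sub>1 * D_energy \<gamma>\<^sub>1 (\<lambda>x. complex_of_real (prod_fun b x)))"
proof -
  define bt where "bt = (\<lambda>j s. b j (t * s))"
  have bt: "bump (bt j)" for j
    unfolding bt_def using bump_affine[OF b, of t j 0] t by simp
  have deriv_bt: "deriv (bt i) s = t * deriv (b i) (t * s)" for i s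
  proof (rule DERIV_imp_deriv)
    have "((*) t has_real_derivative t) (at s)"
      by (auto intro!: derivative_eq_intros)
    from DERIV_chain2[OF bump_has_deriv[OF b] this]
    show "(bt i has_real_derivative t * deriv (b i) (t * s)) (at s)"
      by (simp add: bt_def mult.commute)
  qed
  have pbt: "prod_fun bt x = prod_fun b (t *\<^sub>R x)" for x
    by (simp add: prod_fun_def bt_def)
  have pbt': "prod_fun (bt(i := deriv (bt i))) x = t * prod_fun (b(i := deriv (b i))) (t *\<^sub>R x)" for i x
    unfolding prod_fun_upd deriv_bt by (simp add: bt_def mult.assoc)
  have b': "bump ((b(i := deriv (b i))) j)" for i j
    using b by (intro bump_upd bump_deriv) auto
  have bt': "bump ((bt(i := deriv (bt i))) j)" for i j
    using bt by (intro bump_upd bump_deriv) auto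
  have [measurable]: "prod_fun b \<in> borel_measurable borel" "prod_fun bt \<in> borel_measurable borel"
    using borel_measurable_prod_fun[of b, OF b] borel_measurable_prod_fun[of bt, OF bt] by auto
  have [measurable]: "prod_fun (b(i := deriv (b i))) \<in> borel_measurable borel"
      "prod_fun (bt(i := deriv (bt i))) \<in> borel_measurable borel" for i
    using borel_measurable_prod_fun[of "b(i := deriv (b i))", OF b']
      borel_measurable_prod_fun[of "bt(i := deriv (bt i))", OF bt'] by auto
  have u: "u = (\<lambda>x. complex_of_real (k * prod_fun bt x))"
    by (simp add: u_def bt_def)
  have um: "u \<in> borel_measurable borel" unfolding u by measurable
  have uH: "u \<in> H1_space" unfolding u using bt by (rule prod_fun_H1)
  have "(LINT x|lebesgue. (cmod (u x))\<^sup>2) = (LINT x|lborel. k\<^sup>2 * (prod_fun b (t *\<^sub>R x))\<^sup>2)"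
    unfolding u by (subst integral_completion) (auto simp: pbt norm_mult power_mult_distrib)
  also have "\<dots> = \<kappa> * (LINT x|lborel. (prod_fun b x)\<^sup>2)"
    using integral_lborel_scale[of "\<lambda>x. (prod_fun b x)\<^sup>2" t] t by (simp add: \<kappa>_def)
  finally show "u \<in> mass_sphere (\<kappa> * (LINT x|lborel. (prod_fun b x)\<^sup>2))"
    using uH by (simp add: mass_sphere_def)
  define g where "g i x = complex_of_real (k * prod_fun (bt(i := deriv (bt i))) x)" for i x
  have g: "is_weak_partial i u (g i)" for i
    unfolding u g_def using bt by (rule is_weak_partial_prod_fun)
  have [measurable]: "g i \<in> borel_measurable borel" for i unfolding g_def[abs_def] by measurable
  have g_sq: "(cmod (g i x))\<^sup>2 = k\<^sup>2 * t\<^sup>2 * (prod_fun (b(i := deriv (b i))) (t *\<^sub>R x))\<^sup>2" for i x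
    unfolding g_def pbt' by (simp add: norm_mult power_mult_distrib)
  have "(LINT x|lebesgue. grad_norm_sq u x) = (\<Sum>i\<in>UNIV. LINT x|lborel. (cmod (g i x))\<^sup>2)"
  proof (rule integral_grad_norm_sq[OF weak_partial_measurable[OF uH]])
    show "AE x in lborel. weak_partial i u x = g i x" for i
      by (rule weak_partial_unique[OF is_weak_partial_weak_partial[OF g] g])
    show "integrable lborel (\<lambda>x. (cmod (g i x))\<^sup>2)" for i
      using integrable_square_prod_fun[of "bt(i := deriv (bt i))", OF bt']
      unfolding g_def by (simp add: norm_mult power_mult_distrib)
  qed measurable
  also have "\<dots> = (\<Sum>i\<in>UNIV. \<kappa> * t\<^sup>2 * (LINT x|lborel. (prod_fun (b(i := deriv (b i))) x)\<^sup>2))"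
  proof (rule sum.cong)
    fix i
    show "(LINT x|lborel. (cmod (g i x))\<^sup>2) = \<kappa> * t\<^sup>2 * (LINT x|lborel. (prod_fun (b(i := deriv (b i))) x)\<^sup>2)"
      unfolding g_sq using integral_lborel_scale[of "\<lambda>x. (prod_fun (b(i := deriv (b i))) x)\<^sup>2" t] t
      by (simp add: \<kappa>_def)
  qed simp
  finally have grad: "(LINT x|lebesgue. grad_norm_sq u x)
    = \<kappa> * t\<^sup>2 * (\<Sum>i\<in>UNIV. LINT x|lborel. (prod_fun (b(i := deriv (b i))) x)\<^sup>2)"
    by (simp add: sum_distrib_left)
  have D: "D_energy \<gamma> u = \<kappa>\<^sup>2 * t powr \<gamma> * D_energy \<gamma> (\<lambda>x. complex_of_real (prod_fun b x))" for \<gamma>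
  proof -
    define q where "q x = (prod_fun b x)\<^sup>2" for x
    have [measurable]: "q \<in> borel_measurable borel" unfolding q_def[abs_def] by measurable
    define P where "P x = (LINT y|lborel. q y / norm (x - y) powr \<gamma>)" for x
    have [measurable]: "P \<in> borel_measurable borel" unfolding P_def[abs_def] by measurable
    have "D_energy \<gamma> (\<lambda>x. complex_of_real (prod_fun b x)) = (LINT x|lborel. q x * P x)"
      by (subst D_energy_lborel[where v = "\<lambda>x. complex_of_real (prod_fun b x)"])
         (auto intro: measurable_completion simp: q_def P_def)
    moreover have "D_energy \<gamma> u = \<kappa>\<^sup>2 * t powr \<gamma> * (LINT x|lborel. q x * P x)"
    proof -
      have u_sq: "(cmod (u x))\<^sup>2 = k\<^sup>2 * q (t *\<^sub>R x)" for x
        by (simp add: u q_def pbt norm_mult power_mult_distrib)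
      have inner: "(LINT y|lborel. (cmod (u y))\<^sup>2 / norm (x - y) powr \<gamma>) = \<kappa> * t powr \<gamma> * P (t *\<^sub>R x)" for x
      proof -
        \<comment> \<open>Homogeneity of the kernel rewrites everything in the dilated variables.
          Each of the two changes of variables contributes \<open>1 / t ^ CARD('n)\<close>, which
          together with \<open>k\<close> to the fourth power makes \<kappa> squared.\<close>
        have "(cmod (u y))\<^sup>2 / norm (x - y) powr \<gamma> = k\<^sup>2 * t powr \<gamma> * (q (t *\<^sub>R y) / norm (t *\<^sub>R x - t *\<^sub>R y) powr \<gamma>)" for y
        proof -
          have "norm (t *\<^sub>R x - t *\<^sub>R y) powr \<gamma> = t powr \<gamma> * norm (x - y) powr \<gamma>"
            unfolding scaleR_diff_right[symmetric] using t by (simp add: powr_mult)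
          then show ?thesis using t by (simp add: u_sq)
        qed
        then have "(LINT y|lborel. (cmod (u y))\<^sup>2 / norm (x - y) powr \<gamma>)
          = k\<^sup>2 * t powr \<gamma> * (LINT y|lborel. q (t *\<^sub>R y) / norm (t *\<^sub>R x - t *\<^sub>R y) powr \<gamma>)"
          by (simp only: integral_mult_right_zero)
        also have "(LINT y|lborel. q (t *\<^sub>R y) / norm (t *\<^sub>R x - t *\<^sub>R y) powr \<gamma>) = 1 / t ^ CARD('n) * P (t *\<^sub>R x)"
          using integral_lborel_scale[of "\<lambda>y. q y / norm (t *\<^sub>R x - y) powr \<gamma>" t] t by (simp add: P_def)
        finally show ?thesis by (simp add: \<kappa>_def)
      qed
      have "D_energy \<gamma> u = (LINT x|lborel. (cmod (u x))\<^sup>2 * (LINT y|lborel. (cmod (u y))\<^sup>2 / norm (x - y) powr \<gamma>))"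
        using um by (intro D_energy_lborel measurable_completion) auto
      also have "\<dots> = (LINT x|lborel. (k\<^sup>2 * \<kappa> * t powr \<gamma>) * (q (t *\<^sub>R x) * P (t *\<^sub>R x)))"
        unfolding inner unfolding u_sq by (simp add: ac_simps)
      also have "\<dots> = (k\<^sup>2 * \<kappa> * t powr \<gamma>) * (1 / t ^ CARD('n) * (LINT x|lborel. q x * P x))"
        using integral_lborel_scale[of "\<lambda>x. q x * P x" t] t by simp
      finally show ?thesis by (simp add: \<kappa>_def power2_eq_square)
    qed
    ultimately show ?thesis by simp
  qed
  show "energy \<gamma>\<^sub>1 \<gamma>\<^sub>2 u = 1 / 2 * (\<kappa> * t\<^sup>2 * (\<Sum>i\<in>UNIV. LINT x|lborel. (prod_fun (b(i := deriv (b i))) x)\<^sup>2))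
      + 1 / 4 * (\<kappa>\<^sup>2 * t powr \<gamma>\<^sub>2 * D_energy \<gamma>\<^sub>2 (\<lambda>x. complex_of_real (prod_fun b x)))
      - 1 / 4 * (\<kappa>\<^sup>2 * t powr \<gamma>\<^sub>1 * D_energy \<gamma>\<^sub>1 (\<lambda>x. complex_of_real (prod_fun b x)))"
    unfolding energy_def grad D ..
qed

lemma exists_prod_fun_pos_mass:
  "\<exists>b :: 'n::finite \<Rightarrow> real \<Rightarrow> real. (\<forall>j. bump (b j)) \<and> 0 < (LINT x|lborel. (prod_fun b x)\<^sup>2)"
proof -
  define b where "b = (\<lambda>j::'n. interval_bump 0 1 0)"
  have b: "bump (b j)" for j
    by (simp add: b_def bump_interval_bump)
  have pos: "prod_fun b x \<noteq> 0" if "x \<in> box 0 1" for x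
    using that by (auto simp: prod_fun_def b_def interval_bump_def flat_exp_def mem_box_cart)
  have "(LINT x|lborel. (prod_fun b x)\<^sup>2) \<noteq> 0"
  proof
    assume "(LINT x|lborel. (prod_fun b x)\<^sup>2) = 0"
    then have "AE x in lborel. (prod_fun b x)\<^sup>2 = 0"
      using integrable_square_prod_fun[of b, OF b] by (subst (asm) integral_nonneg_eq_0_iff_AE) auto
    then have "AE x in lborel. x \<notin> box (0 :: real ^ 'n) 1"
      by eventually_elim (use pos in auto)
    \<comment> \<open>A closed set containing almost every point is the whole space; applied to the
      complement of the open cube, this contradicts the midpoint of the cube.\<close>
    then have "AE x in lebesgue. x \<in> - box (0 :: real ^ 'n) 1"
      by (intro AE_completion) simp
    then have "(\<chi> i. 1 / 2) \<in> - box (0 :: real ^ 'n) 1"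
      by (intro mem_closed_if_AE_lebesgue) auto
    then show False by (simp add: mem_box_cart)
  qed
  moreover have "0 \<le> (LINT x|lborel. (prod_fun b x)\<^sup>2)"
    by (intro integral_nonneg_AE) auto
  ultimately show ?thesis using b by (intro exI[of _ b]) (simp add: less_le)
qed

text \<open>At fixed mass the energy of the dilates is a combination of the second power of
  \<open>t\<close>, \<open>t powr \<gamma>\<^sub>2\<close> and
  \<open>t powr \<gamma>\<^sub>1\<close> with fixed real coefficients, so it tends to 0 as the
  profile spreads out.\<close>

lemma exists_small_energy:
  fixes \<gamma>\<^sub>1 \<gamma>\<^sub>2 :: real
  assumes "0 < \<gamma>\<^sub>1" "0 < \<gamma>\<^sub>2" "0 < c" "0 < \<delta>"
  shows "\<exists>u \<in> (mass_sphere c :: (real ^ 'n::finite \<Rightarrow> complex) set). energy \<gamma>\<^sub>1 \<gamma>\<^sub>2 u < \<delta>"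
proof -
  obtain b :: "'n \<Rightarrow> real \<Rightarrow> real" where b: "\<And>j. bump (b j)" and m0: "0 < (LINT x|lborel. (prod_fun b x)\<^sup>2)"
    using exists_prod_fun_pos_mass by blast
  define m where "m = (LINT x|lborel. (prod_fun b x)\<^sup>2)"
  define X where "X = (\<Sum>i\<in>UNIV. LINT x|lborel. (prod_fun (b(i := deriv (b i))) x)\<^sup>2)"
  define Y where "Y \<gamma> = D_energy \<gamma> (\<lambda>x. complex_of_real (prod_fun b x))" for \<gamma>
  define e where "e t = 1 / 2 * (c / m * t\<^sup>2 * X) + 1 / 4 * ((c / m)\<^sup>2 * t powr \<gamma>\<^sub>2 * Y \<gamma>\<^sub>2)
    - 1 / 4 * ((c / m)\<^sup>2 * t powr \<gamma>\<^sub>1 * Y \<gamma>\<^sub>1)" for t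
  have pw: "((\<lambda>t. t powr \<gamma>) \<longlongrightarrow> 0) (at_right 0)" if "0 < \<gamma>" for \<gamma> :: real
    using tendsto_powr'[OF tendsto_ident_at tendsto_const[of \<gamma>], of 0 "{0<..}"] that
    by (auto simp: eventually_at_filter)
  have "(e \<longlongrightarrow> 1 / 2 * (c / m * 0\<^sup>2 * X) + 1 / 4 * ((c / m)\<^sup>2 * 0 * Y \<gamma>\<^sub>2)
    - 1 / 4 * ((c / m)\<^sup>2 * 0 * Y \<gamma>\<^sub>1)) (at_right 0)"
    unfolding e_def[abs_def] using assms by (intro tendsto_intros pw)
  then have "(e \<longlongrightarrow> 0) (at_right 0)" by simp
  then have "\<forall>\<^sub>F t in at_right 0. e t < \<delta>"
    using assms(4) by (rule order_tendstoD)
  then have "\<forall>\<^sub>F t in at_right 0. e t < \<delta> \<and> 0 < t"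
    using eventually_at_right_less by eventually_elim simp
  then obtain t where t: "e t < \<delta>" "0 < t"
    using eventually_happens[of _ "at_right (0::real)"] by auto
  \<comment> \<open>The amplitude for which the mass factor \<kappa> equals \<open>c / m\<close>, so
    that the dilate of a profile of mass \<open>m\<close> has mass \<open>c\<close>.\<close>
  define k where "k = sqrt (c / m * t ^ CARD('n))"
  have \<kappa>: "k\<^sup>2 / t ^ CARD('n) = c / m"
    using assms(3) m0 t(2) by (simp add: k_def m_def)
  define u where "u = (\<lambda>x. complex_of_real (k * prod_fun (\<lambda>j s. b j (t * s)) x))"
  have "u \<in> mass_sphere (c / m * m)"
    using energy_scaling(1)[of b t k, OF b t(2)] unfolding \<kappa> u_def m_def .
  then have "u \<in> mass_sphere c"
    using m0 by (simp add: m_def)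
  moreover have "energy \<gamma>\<^sub>1 \<gamma>\<^sub>2 u = e t"
    using energy_scaling(2)[of b t \<gamma>\<^sub>1 \<gamma>\<^sub>2 k, OF b t(2)] unfolding \<kappa> u_def e_def X_def Y_def .
  ultimately show ?thesis
    using t(1) by (intro bexI[of _ u]) simp_all
qed

theorem theorem1p1:
  fixes \<gamma>\<^sub>1 \<gamma>\<^sub>2 :: real
  assumes "CARD('n::finite) \<ge> 3"
    and "0 < \<gamma>\<^sub>2" and "\<gamma>\<^sub>2 < \<gamma>\<^sub>1" and "\<gamma>\<^sub>1 < min (real CARD('n)) 2"
  shows "\<exists>c\<^sub>0 > 0. \<forall>c. 0 < c \<and> c < c\<^sub>0 \<longrightarrow>
           min_energy TYPE('n) \<gamma>\<^sub>1 \<gamma>\<^sub>2 c = 0 \<and>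
           \<not> (\<exists>u \<in> (mass_sphere c :: (real ^ 'n \<Rightarrow> complex) set).
                 ereal (energy \<gamma>\<^sub>1 \<gamma>\<^sub>2 u) = min_energy TYPE('n) \<gamma>\<^sub>1 \<gamma>\<^sub>2 c)"
\<comment> \<open>The threshold is the one under which \<open>energy_pos\<close> holds.\<close>
proof (intro exI[of _ "1 / 2"] conjI allI impI)
  fix c :: real
  assume c: "0 < c \<and> c < 1 / 2"
  have pos: "0 < energy \<gamma>\<^sub>1 \<gamma>\<^sub>2 u" if "u \<in> mass_sphere c" for u :: "real ^ 'n \<Rightarrow> complex"
    using assms c that by (intro energy_pos[of _ _ _ c]) auto
  show zero: "min_energy TYPE('n) \<gamma>\<^sub>1 \<gamma>\<^sub>2 c = 0"
  proof (rule antisym)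
    show "0 \<le> min_energy TYPE('n) \<gamma>\<^sub>1 \<gamma>\<^sub>2 c"
      unfolding min_energy_def using pos by (intro INF_greatest) (simp add: less_imp_le)
    show "min_energy TYPE('n) \<gamma>\<^sub>1 \<gamma>\<^sub>2 c \<le> 0"
    proof (rule ereal_le_epsilon2)
      fix \<delta> :: real assume "0 < \<delta>"
      then obtain u :: "real ^ 'n \<Rightarrow> complex" where "u \<in> mass_sphere c" "energy \<gamma>\<^sub>1 \<gamma>\<^sub>2 u < \<delta>"
        using exists_small_energy[of \<gamma>\<^sub>1 \<gamma>\<^sub>2 c \<delta>] assms c by auto
      then show "min_energy TYPE('n) \<gamma>\<^sub>1 \<gamma>\<^sub>2 c \<le> 0 + ereal \<delta>"
        unfolding min_energy_def by (auto intro: INF_lower2 less_imp_le)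
    qed
  qed
  show "\<not> (\<exists>u \<in> (mass_sphere c :: (real ^ 'n \<Rightarrow> complex) set).
      ereal (energy \<gamma>\<^sub>1 \<gamma>\<^sub>2 u) = min_energy TYPE('n) \<gamma>\<^sub>1 \<gamma>\<^sub>2 c)"
    unfolding zero using pos by force
qed simp

end
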